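(* Fix $s\ge2$, $\kappa>0$, $\gamma>0$, $0\le\overline\mu<1$, $\rho=\gamma/\kappa$, and let $\mathfrak X_{s,\kappa}(\gamma,\overline\mu)$, $\overline C_2$, $A_\star$, $\eta_\star$ be as defined in the context. Assume $\overline C_2<\frac23$ and $A_\star>0$. For $X,Y\in\mathfrak X_{s,\kappa}(\gamma,\overline\mu)$ let $d_{\rm sp}(X,Y):=\|P_{\mathcal U_X}-P_{\mathcal U_Y}\|_2$. Then for all $X,Y\in\mathfrak X_{s,\kappa}(\gamma,\overline\mu)$ $$d_{\rm sp}(X,Y)\le\frac{\kappa\sqrt s}{\sqrt{3(1-\overline\mu)}}\,d_{\rm match}(X,Y).$$ If, in addition, $d_{\rm sp}(X,Y)<\eta_\star$, then $$d_{\rm match}(X,Y)\le\frac{2}{\sqrt3\,c_{\rm sp}(X,Y)}\frac{d_{\rm sp}(X,Y)}{\kappa},\qquad c_{\rm sp}(X,Y):=\frac23-\overline C_2-\left(\frac2{\sqrt5}+\frac23\right)d_{\rm sp}(X,Y).$$ Consequently, the map $X\mapsto\mathcal U_X$ is locally bi-Lipschitz (comparing $\kappa\,d_{\rm match}(X,Y)$ with $d_{\rm sp}(X,Y)$ when $d_{\rm sp}(X,Y)<\eta_\star$), with constants depending only on $(\gamma,\overline\mu,s)$.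
   Context: $B_r(x)$ is the open Euclidean ball in $\mathbb R^3$. $\mathcal H=L^2(\mathbb S^2,\frac{d\omega}{4\pi})$ (complex), with norm and operator norm $\|\cdot\|_2$; $\varphi_z(\omega)=e^{i\kappa\omega\cdot z}$; for a set $X$ of $s$ distinct points, $\mathcal U_X=\operatorname{span}\{\varphi_x:x\in X\}$, $\delta_X$ is the minimum distance between distinct points of $X$, and $\mu_X=\frac92\frac{s^{2/3}}{\kappa\delta_X}$. $P_{\mathcal V}$ is the orthogonal projector onto $\mathcal V$. $\mathcal X_s(B_1)$ is the set of unordered $s$-point subsets of $B_1(0)$, with $d_{\rm match}(X,Y)=\min_{\pi\in S_s}\max_{1\le j\le s}|x_j-y_{\pi(j)}|$. The uniform class is $$\mathfrak X_{s,\kappa}(\gamma,\overline\mu)=\Bigl\{X\in\mathcal X_s(B_1):\ \bigcup_{x\in X}\overline{B_\rho(x)}\subset B_1(0),\ \rho\le\tfrac{\delta_X}2,\ \mu_X\le\overline\mu\Bigr\}.$$ Constants: $c_\nu=\sup_{t>0}|t\cos t-\sin t|/t$, $b_\gamma=1-\sup_{t\ge\gamma}(\sin t/t)^2$, $$\overline\nu=\frac{64c_\nu^2}{27}\frac{\overline\mu^2}{s},\qquad \overline C_1=\frac{\gamma^2}9+\overline\nu+\sqrt{1+\overline\nu}\sqrt{\left(\tfrac13+\tfrac{\gamma^2}{10}\right)^2+4\overline\nu},\qquad \overline C_2=\frac{8\gamma^2}{15}+6\overline\nu+\frac{2\overline\mu}{1-\overline\mu}\overline C_1,$$ $$A_\star=\frac{b_\gamma-\overline\mu-\overline\nu}{1-\overline\mu},\quad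 \eta_{\rm loc}=\frac{\frac{\sqrt3}2\gamma\left(\frac23-\overline C_2\right)}{1+\frac{\sqrt3}2\gamma\left(\frac2{\sqrt5}+\frac23\right)},\quad \eta_{\rm gap}=\sin\left(\tfrac12\arcsin\sqrt{A_\star}\right),\quad \eta_\star=\min\{\eta_{\rm loc},\eta_{\rm gap}\}.$$ *)

theory Defs
  imports "HOL-Analysis.Analysis" "HOL-Probability.Probability_Measure"
begin

text \<open>
  The normalised surface measure \<open>d\<omega>/(4\<pi>)\<close> on the unit sphere of \<open>\<real>\<^sup>3\<close>, obtained from Lebesgue
  measure in polar coordinates: the surface measure \<open>\<sigma>\<close> satisfies
  \<open>\<sigma> A = 3 * vol {t *\<^sub>R \<omega> | 0 < t < 1, \<omega> \<in> A}\<close>, and \<open>\<sigma>\<close> of the sphere is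
  \<open>4\<pi> = 3 * vol (ball 0 1)\<close>, so \<open>\<sigma>/(4\<pi>)\<close> is the image of the uniform distribution on the unit
  ball under \<open>sgn x = x /\<^sub>R norm x\<close>.
\<close>

definition sphere_measure :: "(real^3) measure" where
  "sphere_measure =
     restrict_space (distr (uniform_measure lborel (ball 0 1)) borel sgn) (sphere 0 1)"

text \<open>
  Elements of \<open>L\<^sup>2\<close> are given by representatives, so \<open>l2_norm\<close> is a seminorm whose null vectors are
  the functions vanishing almost everywhere on the sphere. The values \<open>l2_inner\<close>, \<open>l2_norm\<close> and
  \<open>op_norm\<close> below depend only on the classes modulo almost everywhere equality. Functions live on
  \<open>\<real>\<^sup>3\<close>, but their values off the sphere are irrelevant, as \<open>space sphere_measure = sphere 0 1\<close>.
\<close>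

definition L2 :: "(real^3 \<Rightarrow> complex) set" where
  "L2 = {f \<in> borel_measurable sphere_measure.
           integrable sphere_measure (\<lambda>\<omega>. (cmod (f \<omega>))\<^sup>2)}"

definition l2_inner :: "(real^3 \<Rightarrow> complex) \<Rightarrow> (real^3 \<Rightarrow> complex) \<Rightarrow> complex" where
  "l2_inner f g = (\<integral>\<omega>. f \<omega> * cnj (g \<omega>) \<partial>sphere_measure)"

definition l2_norm :: "(real^3 \<Rightarrow> complex) \<Rightarrow> real" where
  "l2_norm f = sqrt (\<integral>\<omega>. (cmod (f \<omega>))\<^sup>2 \<partial>sphere_measure)"

definition op_norm :: "((real^3 \<Rightarrow> complex) \<Rightarrow> (real^3 \<Rightarrow> complex)) \<Rightarrow> real" where
  "op_norm T = (SUP f \<in> {f \<in> L2. l2_norm f \<le> 1}. l2_norm (T f))"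

text \<open>
  The orthogonal projector onto \<open>V\<close>: for a finite-dimensional subspace \<open>V\<close> of \<open>L2\<close> and \<open>f \<in> L2\<close>
  such a \<open>g\<close> exists and is unique modulo almost everywhere equality.
\<close>

definition orth_proj ::
  "(real^3 \<Rightarrow> complex) set \<Rightarrow> (real^3 \<Rightarrow> complex) \<Rightarrow> (real^3 \<Rightarrow> complex)" where
  "orth_proj V f = (SOME g. g \<in> V \<and> (\<forall>h\<in>V. l2_inner (\<lambda>\<omega>. f \<omega> - g \<omega>) h = 0))"

definition plane_wave :: "real \<Rightarrow> real^3 \<Rightarrow> real^3 \<Rightarrow> complex" where
  "plane_wave \<kappa> z \<omega> = exp (\<i> * complex_of_real (\<kappa> * (\<omega> \<bullet> z)))"

text \<open>The complex linear span of the plane waves of a finite set \<open>X\<close> of points.\<close>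

definition wave_space :: "real \<Rightarrow> (real^3) set \<Rightarrow> (real^3 \<Rightarrow> complex) set" where
  "wave_space \<kappa> X = {(\<lambda>\<omega>. \<Sum>x\<in>X. a x * plane_wave \<kappa> x \<omega>) | a. True}"

definition d_sp :: "real \<Rightarrow> (real^3) set \<Rightarrow> (real^3) set \<Rightarrow> real" where
  "d_sp \<kappa> X Y =
     op_norm (\<lambda>f \<omega>. orth_proj (wave_space \<kappa> X) f \<omega> - orth_proj (wave_space \<kappa> Y) f \<omega>)"

text \<open>
  Enumerating \<open>X\<close> and \<open>Y\<close>, the matchings \<open>x\<^sub>j \<mapsto> y\<^bsub>\<pi>(j)\<^esub>\<close> with \<open>\<pi> \<in> S\<^sub>s\<close> are exactly the
  bijections from \<open>X\<close> to \<open>Y\<close>.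
\<close>

definition d_match :: "(real^3) set \<Rightarrow> (real^3) set \<Rightarrow> real" where
  "d_match X Y = Min {Max ((\<lambda>x. norm (x - p x)) ` X) | p. bij_betw p X Y}"

definition min_sep :: "(real^3) set \<Rightarrow> real" where
  "min_sep X = Min {norm (x - y) | x y. x \<in> X \<and> y \<in> X \<and> x \<noteq> y}"

definition mu_of :: "real \<Rightarrow> (real^3) set \<Rightarrow> real" where
  "mu_of \<kappa> X = 9 / 2 * (real (card X) powr (2 / 3) / (\<kappa> * min_sep X))"

definition configs :: "nat \<Rightarrow> (real^3) set set" where
  "configs s = {X. finite X \<and> card X = s \<and> X \<subseteq> ball 0 1}"

definition uniform_class :: "nat \<Rightarrow> real \<Rightarrow> real \<Rightarrow> real \<Rightarrow> (real^3) set set" where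
  "uniform_class s \<kappa> \<gamma> \<mu> =
     {X \<in> configs s.
        (\<Union>x\<in>X. cball x (\<gamma> / \<kappa>)) \<subseteq> ball 0 1 \<and> \<gamma> / \<kappa> \<le> min_sep X / 2 \<and> mu_of \<kappa> X \<le> \<mu>}"

definition c_nu :: real where
  "c_nu = (SUP t \<in> {0<..}. \<bar>t * cos t - sin t\<bar> / t)"

definition b_const :: "real \<Rightarrow> real" where
  "b_const \<gamma> = 1 - (SUP t \<in> {\<gamma>..}. (sin t / t)\<^sup>2)"

definition nu_bar :: "nat \<Rightarrow> real \<Rightarrow> real" where
  "nu_bar s \<mu> = 64 * c_nu\<^sup>2 / 27 * (\<mu>\<^sup>2 / real s)"

definition C1_bar :: "nat \<Rightarrow> real \<Rightarrow> real \<Rightarrow> real" where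
  "C1_bar s \<gamma> \<mu> =
     \<gamma>\<^sup>2 / 9 + nu_bar s \<mu>
     + sqrt (1 + nu_bar s \<mu>) * sqrt ((1 / 3 + \<gamma>\<^sup>2 / 10)\<^sup>2 + 4 * nu_bar s \<mu>)"

definition C2_bar :: "nat \<Rightarrow> real \<Rightarrow> real \<Rightarrow> real" where
  "C2_bar s \<gamma> \<mu> =
     8 * \<gamma>\<^sup>2 / 15 + 6 * nu_bar s \<mu> + 2 * \<mu> / (1 - \<mu>) * C1_bar s \<gamma> \<mu>"

definition A_star :: "nat \<Rightarrow> real \<Rightarrow> real \<Rightarrow> real" where
  "A_star s \<gamma> \<mu> = (b_const \<gamma> - \<mu> - nu_bar s \<mu>) / (1 - \<mu>)"

definition eta_loc :: "nat \<Rightarrow> real \<Rightarrow> real \<Rightarrow> real" where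
  "eta_loc s \<gamma> \<mu> =
     (sqrt 3 / 2 * \<gamma> * (2 / 3 - C2_bar s \<gamma> \<mu>))
     / (1 + sqrt 3 / 2 * \<gamma> * (2 / sqrt 5 + 2 / 3))"

definition eta_gap :: "nat \<Rightarrow> real \<Rightarrow> real \<Rightarrow> real" where
  "eta_gap s \<gamma> \<mu> = sin (1 / 2 * arcsin (sqrt (A_star s \<gamma> \<mu>)))"

definition eta_star :: "nat \<Rightarrow> real \<Rightarrow> real \<Rightarrow> real" where
  "eta_star s \<gamma> \<mu> = min (eta_loc s \<gamma> \<mu>) (eta_gap s \<gamma> \<mu>)"

definition c_sp ::
  "nat \<Rightarrow> real \<Rightarrow> real \<Rightarrow> real \<Rightarrow> (real^3) set \<Rightarrow> (real^3) set \<Rightarrow> real" where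
  "c_sp s \<kappa> \<gamma> \<mu> X Y = 2 / 3 - C2_bar s \<gamma> \<mu> - (2 / sqrt 5 + 2 / 3) * d_sp \<kappa> X Y"

end

theory Submission
  imports Defs
begin

text \<open>
  The inner product of two plane waves is \<open>sinc (\<kappa> |x - y|)\<close>: the function \<open>g t = \<integral> cos (t \<omega>\<^sub>3)\<close> satisfies
  \<open>t g'' + 2 g' + t g = 0\<close> by invariance under infinitesimal rotations. Since at most
  \<open>((2 r + \<delta>) / \<delta>)\<^sup>3\<close> points with mutual distances at least \<open>\<delta>\<close> lie within distance \<open>r\<close> of a given
  point, Gershgorin's theorem bounds the Gram matrix of the waves from below by \<open>1 - \<mu>\<close>, and the
  squares of \<open>sinc\<close> and \<open>sinc'\<close> at all points but the nearest one sum up to at most \<open>\<nu>\<close>.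

  The upper bound follows by comparing \<open>\<Sum> a\<^sub>j \<phi>\<^bsub>x\<^sub>j\<^esub>\<close> with \<open>\<Sum> a\<^sub>j \<phi>\<^bsub>y\<^sub>j\<^esub>\<close>. Conversely, \<open>d\<^bsub>sp\<^esub>\<close> dominates the
  distance of \<open>\<phi>\<^sub>y\<close> from \<open>U\<^sub>X\<close> for \<open>y \<in> Y\<close>. The square of this distance is at least \<open>A\<^sub>\<star>\<close> if \<open>y\<close> is not within
  \<open>\<rho>\<close> of a point of \<open>X\<close>, so a smaller \<open>d\<^bsub>sp\<^esub>\<close> forces a bijection of \<open>X\<close> and \<open>Y\<close> moving points by less
  than \<open>\<rho>\<close>; and if \<open>|y - x| \<le> \<rho>\<close>, the projection to \<open>U\<^sub>X\<close> of \<open>\<phi>\<^sub>y - \<phi>\<^sub>x\<close>, a vector of norm about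
  \<open>\<kappa> |y - x| / \<surd>3\<close>, is small, because \<open>\<phi>\<^sub>y - \<phi>\<^sub>x\<close> is almost orthogonal to all waves of \<open>X\<close>.
\<close>

section \<open>Normalised surface measure on the sphere\<close>

abbreviation ball_measure :: "(real^3) measure" where
  "ball_measure \<equiv> uniform_measure lborel (ball 0 1)"

lemma emeasure_unit_ball:
  "emeasure lborel (ball (0::real^3) 1) \<noteq> 0" "emeasure lborel (ball (0::real^3) 1) \<noteq> \<infinity>"
proof -
  show "emeasure lborel (ball (0::real^3) 1) \<noteq> \<infinity>"
    using emeasure_lborel_ball_finite[of "0::real^3" 1] by simp
  have "measure lborel (ball (0::real^3) 1) > 0"
    by (simp add: content_ball_pos)
  then show "emeasure lborel (ball (0::real^3) 1) \<noteq> 0"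
    by (auto simp: measure_def)
qed

lemma measurable_sgn_vec [measurable]: "(sgn :: real^3 \<Rightarrow> real^3) \<in> borel_measurable borel"
  unfolding sgn_div_norm by measurable

lemma space_sphere_measure [simp]: "space sphere_measure = sphere 0 1"
  by (simp add: sphere_measure_def space_restrict_space)

text \<open>\<open>sgn\<close> sends every point but the origin to the sphere, and the origin is a
  null set, so restricting to the sphere loses no mass.\<close>

lemma prob_space_sphere_measure: "prob_space sphere_measure"
proof -
  have *: "sphere (0::real^3) 1 \<in> sets borel"
    by (simp add: borel_closed)
  have "emeasure (distr ball_measure borel sgn) (sphere 0 1)
      = emeasure ball_measure (sgn -` sphere 0 1 \<inter> space ball_measure)"
    using * by (subst emeasure_distr) simp_all
  also have "sgn -` sphere 0 1 \<inter> space ball_measure = - {0::real^3}"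
    by (auto simp: norm_sgn)
  also have "emeasure ball_measure (- {0})
      = emeasure lborel (ball (0::real^3) 1 \<inter> - {0}) / emeasure lborel (ball (0::real^3) 1)"
    by (subst emeasure_uniform_measure) simp_all
  also have "ball (0::real^3) 1 \<inter> - {0} = ball 0 1 - {0}"
    by auto
  also have "emeasure lborel (ball (0::real^3) 1 - {0}) = emeasure lborel (ball (0::real^3) 1)"
    by (subst emeasure_Diff) simp_all
  also have "\<dots> / emeasure lborel (ball (0::real^3) 1) = 1"
    using emeasure_unit_ball by (intro ennreal_divide_self) (auto simp: top.not_eq_extremum)
  finally have "emeasure (distr ball_measure borel sgn) (sphere 0 1) = 1" .
  with * show ?thesis
    unfolding sphere_measure_def by (intro prob_space_restrict_space) simp_all
qed

interpretation S: prob_space sphere_measure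
  by (rule prob_space_sphere_measure)

lemma borel_measurable_sphere_measure:
  assumes "f \<in> borel_measurable borel"
  shows "f \<in> borel_measurable sphere_measure"
  using assms unfolding sphere_measure_def by (intro measurable_restrict_space1) simp

text \<open>Reduces integrals over the sphere to integrals over the solid ball. The indicator
  vanishes only at the origin, where \<open>sgn\<close> is \<open>0\<close>.\<close>

lemma integral_sphere_measure:
  fixes f :: "real^3 \<Rightarrow> 'b::{banach, second_countable_topology}"
  assumes [measurable]: "f \<in> borel_measurable borel"
  shows "(\<integral>\<omega>. f \<omega> \<partial>sphere_measure)
    = (\<integral>x. indicat_real (sphere 0 1) (sgn x) *\<^sub>R f (sgn x) \<partial>ball_measure)"
proof -
  have [measurable]: "sphere (0::real^3) 1 \<in> sets borel"
    by (simp add: borel_closed)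
  show ?thesis
    unfolding sphere_measure_def
    by (subst integral_restrict_space, simp, subst integral_distr) simp_all
qed

text \<open>An orthogonal map preserves volume and maps the unit ball onto itself, so the part of
  the ball that \<open>T\<close> sends into \<open>A\<close> has the same volume as the part inside
  \<open>A\<close>.\<close>

lemma ball_measure_orthogonal:
  assumes "orthogonal_transformation (T :: real^3 \<Rightarrow> real^3)"
  shows "distr ball_measure borel T = ball_measure"
proof (rule measure_eqI)
  have lin: "linear T"
    using assms by (rule orthogonal_transformation_linear)
  have T[measurable]: "T \<in> borel_measurable borel"
    using lin by (simp add: borel_measurable_continuous_onI linear_continuous_on linear_linear)
  fix A assume "A \<in> sets (distr ball_measure borel T)"
  then have A[measurable]: "A \<in> sets borel" by simp
  have "ball (0::real^3) 1 \<in> fmeasurable lborel"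
    by (intro fmeasurableI) (use emeasure_lborel_ball_finite[of "0::real^3" 1] in simp_all)
  then have fm: "B \<in> fmeasurable lborel" if "B \<in> sets borel" "B \<subseteq> ball (0::real^3) 1" for B
    using that by (intro fmeasurableI2[of "ball 0 1" lborel B]) simp_all
  let ?B = "ball 0 1 \<inter> T -` A"
  have TA: "T -` A \<in> sets borel"
    using measurable_sets[OF T A] by simp
  have B: "?B \<in> fmeasurable lborel"
    using TA by (intro fm) auto
  have BA: "ball 0 1 \<inter> A \<in> fmeasurable lborel"
    by (intro fm) auto
  have "T ` ball 0 1 = ball 0 1"
    using image_orthogonal_transformation_ball[OF assms, of 0 1] lin by (simp add: linear_0)
  moreover have "T ` ?B = T ` ball 0 1 \<inter> A"
    by blast
  ultimately have im: "T ` ?B = ball 0 1 \<inter> A"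
    by simp
  have "?B \<in> lmeasurable"
    using B by (simp add: fmeasurable_def)
  then have "measure lebesgue (T ` ?B) = measure lebesgue ?B"
    by (rule measure_orthogonal_image[OF assms])
  then have "measure lborel (ball 0 1 \<inter> A) = measure lborel ?B"
    by (simp only: im measure_completion[OF fmeasurableD[OF B]] measure_completion[OF fmeasurableD[OF BA]])
  then have eq: "emeasure lborel (ball 0 1 \<inter> A) = emeasure lborel ?B"
    using B BA by (simp add: emeasure_eq_measure2)
  have "emeasure (distr ball_measure borel T) A = emeasure ball_measure (T -` A)"
    by (subst emeasure_distr) simp_all
  also have "\<dots> = emeasure lborel ?B / emeasure lborel (ball (0::real^3) 1)"
    using TA by (subst emeasure_uniform_measure) simp_all
  also have "\<dots> = emeasure ball_measure A"
    by (subst emeasure_uniform_measure) (simp_all add: eq)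
  finally show "emeasure (distr ball_measure borel T) A = emeasure ball_measure A" .
qed simp

text \<open>\<open>T\<close> commutes with \<open>sgn\<close> and preserves the sphere, so
  invariance passes from the ball to its radial image.\<close>

lemma integral_sphere_orthogonal:
  fixes f :: "real^3 \<Rightarrow> 'b::{banach, second_countable_topology}"
  assumes T: "orthogonal_transformation T" and f[measurable]: "f \<in> borel_measurable borel"
  shows "(\<integral>\<omega>. f (T \<omega>) \<partial>sphere_measure) = (\<integral>\<omega>. f \<omega> \<partial>sphere_measure)"
proof -
  have lin: "linear T"
    using T by (rule orthogonal_transformation_linear)
  have [measurable]: "T \<in> borel_measurable borel"
    using lin by (simp add: borel_measurable_continuous_onI linear_continuous_on linear_linear)
  have [measurable]: "sphere (0::real^3) 1 \<in> sets borel"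
    by (simp add: borel_closed)
  have sgnT: "T (sgn x) = sgn (T x)" for x
    using lin orthogonal_transformation_norm[OF T, of x] by (simp add: sgn_div_norm linear_cmul)
  have ind: "indicat_real (sphere 0 1) (T x) = indicat_real (sphere 0 1) x" for x
    using orthogonal_transformation_norm[OF T, of x] by (simp add: indicator_def)
  define h where "h x = indicat_real (sphere 0 1) (sgn x) *\<^sub>R f (sgn x)" for x
  have [measurable]: "h \<in> borel_measurable borel"
    unfolding h_def by measurable
  have "(\<integral>\<omega>. f (T \<omega>) \<partial>sphere_measure) = (\<integral>x. h (T x) \<partial>ball_measure)"
    by (subst integral_sphere_measure) (simp_all add: h_def ind sgnT[symmetric])
  also have "\<dots> = (\<integral>x. h x \<partial>distr ball_measure borel T)"
    by (subst integral_distr) simp_all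
  also have "\<dots> = (\<integral>x. h x \<partial>ball_measure)"
    by (simp add: ball_measure_orthogonal[OF T])
  also have "\<dots> = (\<integral>\<omega>. f \<omega> \<partial>sphere_measure)"
    using integral_sphere_measure[OF f] by (simp add: h_def[abs_def])
  finally show ?thesis .
qed

section \<open>Differentiation under the integral sign\<close>

text \<open>The mean value inequality is used twice: for \<open>q'\<close>, and then for
  \<open>q\<close> minus its linear part on the segment from \<open>s\<close> to \<open>t\<close>.
  The constant is twice the sharp one; only the quadratic order matters.\<close>

lemma taylor_quadratic_bound:
  fixes q q' q'' :: "real \<Rightarrow> real"
  assumes q: "\<And>s. (q has_real_derivative q' s) (at s)"
    and q': "\<And>s. (q' has_real_derivative q'' s) (at s)"
    and C: "\<And>s. \<bar>q'' s\<bar> \<le> C"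
  shows "\<bar>q t - q s - (t - s) * q' s\<bar> \<le> C * (t - s)\<^sup>2"
proof -
  have lip: "norm (q' x - q' s) \<le> C * norm (x - s)" for x
  proof (rule field_differentiable_bound[OF convex_UNIV])
    show "(q' has_real_derivative q'' z) (at z within UNIV)" for z
      using q'[of z] by simp
    show "norm (q'' z) \<le> C" for z
      using C[of z] by simp
  qed simp_all
  have "C \<ge> 0"
    using C[of 0] by linarith
  have "norm ((q t - t * q' s) - (q s - s * q' s)) \<le> C * \<bar>t - s\<bar> * norm (t - s)"
  proof (rule field_differentiable_bound[of "closed_segment s t"])
    fix x assume x: "x \<in> closed_segment s t"
    have "(q has_real_derivative q' x) (at x within closed_segment s t)"
      using q by (rule DERIV_subset) simp
    then show "((\<lambda>x. q x - x * q' s) has_real_derivative q' x - q' s) (at x within closed_segment s t)"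
      by (auto intro!: derivative_eq_intros)
    have "\<bar>x - s\<bar> \<le> \<bar>t - s\<bar>"
      using x by (auto simp: closed_segment_eq_real_ivl split: if_splits)
    then have "C * \<bar>x - s\<bar> \<le> C * \<bar>t - s\<bar>"
      using \<open>C \<ge> 0\<close> by (rule mult_left_mono)
    then show "norm (q' x - q' s) \<le> C * \<bar>t - s\<bar>"
      using lip[of x] by simp
  qed simp_all
  moreover have "(q t - t * q' s) - (q s - s * q' s) = q t - q s - (t - s) * q' s"
    by (simp add: algebra_simps)
  ultimately show ?thesis
    by (simp add: power2_eq_square mult.assoc)
qed

text \<open>The bound on the second derivative makes the first-order Taylor remainder at most
  \<open>C * h\<^sup>2\<close> uniformly in \<open>x\<close>; after integration, the difference
  quotient is off by at most \<open>D * \<bar>h\<bar>\<close>.\<close>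

lemma has_real_derivative_integral:
  fixes f f' f'' :: "real \<Rightarrow> 'a \<Rightarrow> real"
  assumes "finite_measure M"
    and int: "\<And>s. integrable M (f s)" "\<And>s. integrable M (f' s)"
    and f: "\<And>s x. x \<in> space M \<Longrightarrow> ((\<lambda>s. f s x) has_real_derivative f' s x) (at s)"
    and f': "\<And>s x. x \<in> space M \<Longrightarrow> ((\<lambda>s. f' s x) has_real_derivative f'' s x) (at s)"
    and C: "\<And>s x. x \<in> space M \<Longrightarrow> \<bar>f'' s x\<bar> \<le> C"
  shows "((\<lambda>s. \<integral>x. f s x \<partial>M) has_real_derivative (\<integral>x. f' t x \<partial>M)) (at t)"
proof -
  interpret finite_measure M by fact
  define D where "D = C * measure M (space M)"
  have bound: "\<bar>(\<integral>x. f (t + h) x \<partial>M) - (\<integral>x. f t x \<partial>M) - h * (\<integral>x. f' t x \<partial>M)\<bar> \<le> D * h\<^sup>2" for h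
  proof -
    have "(\<integral>x. f (t + h) x \<partial>M) - (\<integral>x. f t x \<partial>M) - h * (\<integral>x. f' t x \<partial>M)
      = (\<integral>x. f (t + h) x - f t x - h * f' t x \<partial>M)"
      using int by simp
    also have "\<bar>\<dots>\<bar> \<le> (\<integral>x. \<bar>f (t + h) x - f t x - h * f' t x\<bar> \<partial>M)"
      by (rule integral_abs_bound)
    also have "\<dots> \<le> (\<integral>x. C * h\<^sup>2 \<partial>M)"
    proof (rule integral_mono)
      show "integrable M (\<lambda>x. \<bar>f (t + h) x - f t x - h * f' t x\<bar>)"
        using int by (intro integrable_abs Bochner_Integration.integrable_diff integrable_mult_right) auto
      show "\<bar>f (t + h) x - f t x - h * f' t x\<bar> \<le> C * h\<^sup>2" if "x \<in> space M" for x
        using taylor_quadratic_bound[OF f f' C, OF that that that, of "t + h" t] by simp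
    qed simp
    finally show ?thesis
      by (simp add: D_def mult_ac)
  qed
  have "(\<lambda>h. ((\<integral>x. f (t + h) x \<partial>M) - (\<integral>x. f t x \<partial>M)) / h - (\<integral>x. f' t x \<partial>M)) \<midarrow>0\<rightarrow> 0"
  proof (rule Lim_null_comparison)
    show "\<forall>\<^sub>F h in at 0. norm (((\<integral>x. f (t + h) x \<partial>M) - (\<integral>x. f t x \<partial>M)) / h - (\<integral>x. f' t x \<partial>M)) \<le> D * \<bar>h\<bar>"
    proof (rule eventually_at_filter[THEN iffD2], rule always_eventually, intro allI impI)
      fix h :: real assume "h \<noteq> 0"
      then have "norm (((\<integral>x. f (t + h) x \<partial>M) - (\<integral>x. f t x \<partial>M)) / h - (\<integral>x. f' t x \<partial>M))
        = \<bar>((\<integral>x. f (t + h) x \<partial>M) - (\<integral>x. f t x \<partial>M) - h * (\<integral>x. f' t x \<partial>M)) / h\<bar>"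
        by (simp add: field_simps)
      also have "\<dots> \<le> D * h\<^sup>2 / \<bar>h\<bar>"
        unfolding abs_divide using bound[of h] by (intro divide_right_mono) auto
      also have "\<dots> = D * \<bar>h\<bar>"
        using \<open>h \<noteq> 0\<close> by (simp add: power2_eq_square field_simps)
      finally show "norm (((\<integral>x. f (t + h) x \<partial>M) - (\<integral>x. f t x \<partial>M)) / h - (\<integral>x. f' t x \<partial>M)) \<le> D * \<bar>h\<bar>" .
    qed
    show "(\<lambda>h. D * \<bar>h\<bar>) \<midarrow>0\<rightarrow> 0"
      by (auto intro!: tendsto_eq_intros)
  qed
  then show ?thesis
    unfolding DERIV_def by (simp add: LIM_zero_iff)
qed

section \<open>The spherical mean of a plane wave\<close>

text \<open>The quotient \<open>sin t / t\<close> is \<open>0\<close> at \<open>0\<close> by the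
  convention for division; the value \<open>1\<close> is the continuous extension and the diagonal
  entry of the Gram matrix of plane waves.\<close>

definition sinc :: "real \<Rightarrow> real" where
  "sinc t = (if t = 0 then 1 else sin t / t)"

lemma integrable_sphere_bounded:
  fixes f :: "real^3 \<Rightarrow> 'b::{banach, second_countable_topology}"
  assumes "f \<in> borel_measurable borel" and "\<And>\<omega>. norm \<omega> = 1 \<Longrightarrow> norm (f \<omega>) \<le> B"
  shows "integrable sphere_measure f"
  using assms by (intro S.integrable_const_bound[of _ B] borel_measurable_sphere_measure AE_I2) auto

text \<open>Rotation by the angle \<theta> in the plane of the coordinates \<open>i\<close> and
  \<open>3\<close>; meaningful for \<open>i \<noteq> 3\<close>.\<close>

definition rot :: "3 \<Rightarrow> real \<Rightarrow> real^3 \<Rightarrow> real^3" where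
  "rot i \<theta> \<omega> = (\<chi> k. if k = i then \<omega> $ i * cos \<theta> - \<omega> $ 3 * sin \<theta>
     else if k = 3 then \<omega> $ i * sin \<theta> + \<omega> $ 3 * cos \<theta> else \<omega> $ k)"

lemma rot_orthogonal:
  assumes "i \<noteq> 3"
  shows "orthogonal_transformation (rot i \<theta>)"
  unfolding orthogonal_transformation
proof
  show "linear (rot i \<theta>)"
    by (rule linearI) (auto simp: rot_def vec_eq_iff algebra_simps)
  have *: "(a * cos \<theta> - b * sin \<theta>)\<^sup>2 + (a * sin \<theta> + b * cos \<theta>)\<^sup>2 = a\<^sup>2 + b\<^sup>2" for a b :: real
    using sin_cos_squared_add[of \<theta>] by algebra
  have i: "i = 1 \<or> i = 2"
    using assms exhaust_3[of i] by auto
  show "\<forall>\<omega>. norm (rot i \<theta> \<omega>) = norm \<omega>"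
  proof
    fix \<omega> :: "real^3"
    have "(rot i \<theta> \<omega> $ 1)\<^sup>2 + (rot i \<theta> \<omega> $ 2)\<^sup>2 + (rot i \<theta> \<omega> $ 3)\<^sup>2
        = (\<omega> $ 1)\<^sup>2 + (\<omega> $ 2)\<^sup>2 + (\<omega> $ 3)\<^sup>2"
      using i *[of "\<omega> $ 1" "\<omega> $ 3"] *[of "\<omega> $ 2" "\<omega> $ 3"] by (auto simp: rot_def)
    then show "norm (rot i \<theta> \<omega>) = norm \<omega>"
      by (simp add: norm_vec_def L2_set_def sum_3)
  qed
qed

lemma abs_mult_le_one: "\<bar>a * b\<bar> \<le> 1" if "\<bar>a\<bar> \<le> 1" "\<bar>b\<bar> \<le> 1" for a b :: real
  using mult_mono[OF that] by (simp add: abs_mult)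

lemma sphere_component_le: "\<bar>\<omega> $ k\<bar> \<le> 1" if "norm \<omega> = 1" for \<omega> :: "real^3"
  using component_le_norm_cart[of \<omega> k] that by simp

text \<open>Rotating \<open>\<omega>\<^sub>i sin (t \<omega>\<^sub>3)\<close> in the \<open>(i, 3)\<close>-plane does not change its integral; this is the
  derivative at angle \<open>0\<close>.\<close>

lemma infinitesimal_rotation:
  assumes "i \<noteq> 3"
  shows "(\<integral>\<omega>. t * (\<omega> $ i)\<^sup>2 * cos (t * \<omega> $ 3) - \<omega> $ 3 * sin (t * \<omega> $ 3) \<partial>sphere_measure) = 0"
proof -
  define a where "a \<theta> \<omega> = \<omega> $ i * cos \<theta> - \<omega> $ 3 * sin \<theta>" for \<theta> and \<omega> :: "real^3"
  define b where "b \<theta> \<omega> = \<omega> $ i * sin \<theta> + \<omega> $ 3 * cos \<theta>" for \<theta> and \<omega> :: "real^3"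
  \<comment> \<open>In the angle, \<open>a\<close> has derivative \<open>- b\<close> and
    \<open>b\<close> has derivative \<open>a\<close>, so \<open>q'\<close> and \<open>q''\<close>
    are the first two derivatives of \<open>q\<close>; the bound on \<open>q''\<close> allows
    differentiation under the integral.\<close>
  define q where "q \<theta> \<omega> = a \<theta> \<omega> * sin (t * b \<theta> \<omega>)" for \<theta> \<omega>
  define q' where "q' \<theta> \<omega> = t * (a \<theta> \<omega>)\<^sup>2 * cos (t * b \<theta> \<omega>) - b \<theta> \<omega> * sin (t * b \<theta> \<omega>)" for \<theta> \<omega>
  define q'' where "q'' \<theta> \<omega> = - a \<theta> \<omega> * sin (t * b \<theta> \<omega>) - 3 * t * (a \<theta> \<omega> * b \<theta> \<omega>) * cos (t * b \<theta> \<omega>)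
     - t\<^sup>2 * (a \<theta> \<omega>)^3 * sin (t * b \<theta> \<omega>)" for \<theta> \<omega>
  have ab: "a \<theta> \<omega> = rot i \<theta> \<omega> $ i" "b \<theta> \<omega> = rot i \<theta> \<omega> $ 3" for \<theta> \<omega>
    using assms by (auto simp: a_def b_def rot_def)
  have norm_rot: "norm (rot i \<theta> \<omega>) = norm \<omega>" for \<theta> \<omega>
    using orthogonal_transformation_norm[OF rot_orthogonal[OF assms]] .
  have le: "\<bar>a \<theta> \<omega>\<bar> \<le> 1" "\<bar>b \<theta> \<omega>\<bar> \<le> 1" if "norm \<omega> = 1" for \<theta> \<omega>
    unfolding ab using sphere_component_le[of "rot i \<theta> \<omega>"] norm_rot[of \<theta> \<omega>] that by simp_all
  have da: "((\<lambda>\<theta>. a \<theta> \<omega>) has_real_derivative - b \<theta> \<omega>) (at \<theta>)" for \<theta> \<omega>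
    unfolding a_def b_def by (auto intro!: derivative_eq_intros)
  have db: "((\<lambda>\<theta>. b \<theta> \<omega>) has_real_derivative a \<theta> \<omega>) (at \<theta>)" for \<theta> \<omega>
    unfolding a_def b_def by (auto intro!: derivative_eq_intros)
  have cont: "continuous_on UNIV (a \<theta>)" "continuous_on UNIV (b \<theta>)" for \<theta>
    unfolding a_def b_def by (auto intro!: continuous_intros)
  have meas: "q \<theta> \<in> borel_measurable borel" "q' \<theta> \<in> borel_measurable borel" for \<theta>
    unfolding q_def q'_def by (auto intro!: borel_measurable_continuous_onI continuous_intros cont)
  have bd: "\<bar>q \<theta> \<omega>\<bar> \<le> 1" "\<bar>q' \<theta> \<omega>\<bar> \<le> \<bar>t\<bar> + 1" "\<bar>q'' \<theta> \<omega>\<bar> \<le> 1 + 3 * \<bar>t\<bar> + t\<^sup>2" if w: "norm \<omega> = 1" for \<theta> \<omega>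
  proof -
    have 1: "\<bar>a \<theta> \<omega> * sin (t * b \<theta> \<omega>)\<bar> \<le> 1" "\<bar>b \<theta> \<omega> * sin (t * b \<theta> \<omega>)\<bar> \<le> 1"
      using le[OF w] by (auto intro!: abs_mult_le_one)
    have 2: "\<bar>(a \<theta> \<omega>)\<^sup>2 * cos (t * b \<theta> \<omega>)\<bar> \<le> 1" "\<bar>a \<theta> \<omega> * b \<theta> \<omega> * cos (t * b \<theta> \<omega>)\<bar> \<le> 1"
      "\<bar>(a \<theta> \<omega>)^3 * sin (t * b \<theta> \<omega>)\<bar> \<le> 1"
      using le[OF w] unfolding power2_eq_square power3_eq_cube by (auto intro!: abs_mult_le_one)
    have 3: "\<bar>t * ((a \<theta> \<omega>)\<^sup>2 * cos (t * b \<theta> \<omega>))\<bar> \<le> \<bar>t\<bar>"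
      "\<bar>3 * t * (a \<theta> \<omega> * b \<theta> \<omega> * cos (t * b \<theta> \<omega>))\<bar> \<le> 3 * \<bar>t\<bar>"
      "\<bar>t\<^sup>2 * ((a \<theta> \<omega>)^3 * sin (t * b \<theta> \<omega>))\<bar> \<le> t\<^sup>2"
      using mult_left_mono[OF 2(1), of "\<bar>t\<bar>"] mult_left_mono[OF 2(2), of "3 * \<bar>t\<bar>"]
        mult_left_mono[OF 2(3), of "t\<^sup>2"] by (simp_all add: abs_mult)
    show "\<bar>q \<theta> \<omega>\<bar> \<le> 1"
      using 1 by (simp add: q_def)
    show "\<bar>q' \<theta> \<omega>\<bar> \<le> \<bar>t\<bar> + 1"
      using 1(2) 3(1) unfolding q'_def mult.assoc by linarith
    show "\<bar>q'' \<theta> \<omega>\<bar> \<le> 1 + 3 * \<bar>t\<bar> + t\<^sup>2"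
      using 1(1) 3(2,3) unfolding q''_def mult.assoc by linarith
  qed
  have "((\<lambda>\<theta>. \<integral>\<omega>. q \<theta> \<omega> \<partial>sphere_measure) has_real_derivative (\<integral>\<omega>. q' 0 \<omega> \<partial>sphere_measure)) (at 0)"
  proof (rule has_real_derivative_integral)
    show "finite_measure sphere_measure" by (rule S.finite_measure_axioms)
    show "integrable sphere_measure (q \<theta>)" "integrable sphere_measure (q' \<theta>)" for \<theta>
      using integrable_sphere_bounded[OF meas(1), of \<theta> 1] integrable_sphere_bounded[OF meas(2), of \<theta> "\<bar>t\<bar> + 1"] bd
      by auto
    show "((\<lambda>\<theta>. q \<theta> \<omega>) has_real_derivative q' \<theta> \<omega>) (at \<theta>)" for \<theta> \<omega>
      unfolding q_def q'_def
      by (rule derivative_eq_intros da db refl)+ (simp add: power2_eq_square algebra_simps)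
    show "((\<lambda>\<theta>. q' \<theta> \<omega>) has_real_derivative q'' \<theta> \<omega>) (at \<theta>)" for \<theta> \<omega>
      unfolding q'_def q''_def
      by (rule derivative_eq_intros da db refl)+ (simp add: power2_eq_square power3_eq_cube algebra_simps)
    show "\<bar>q'' \<theta> \<omega>\<bar> \<le> 1 + 3 * \<bar>t\<bar> + t\<^sup>2" if "\<omega> \<in> space sphere_measure" for \<theta> \<omega>
      using bd(3)[of \<omega>] that by simp
  qed
  moreover have "(\<integral>\<omega>. q \<theta> \<omega> \<partial>sphere_measure) = (\<integral>\<omega>. q 0 \<omega> \<partial>sphere_measure)" for \<theta>
  proof -
    have q: "q \<theta> \<omega> = q 0 (rot i \<theta> \<omega>)" for \<omega>
      by (simp add: q_def ab) (simp add: rot_def)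
    show ?thesis
      unfolding q by (rule integral_sphere_orthogonal[OF rot_orthogonal[OF assms] meas(1)])
  qed
  then have "(\<lambda>\<theta>. \<integral>\<omega>. q \<theta> \<omega> \<partial>sphere_measure) = (\<lambda>\<theta>. \<integral>\<omega>. q 0 \<omega> \<partial>sphere_measure)"
    by (rule ext)
  ultimately have "((\<lambda>\<theta>. \<integral>\<omega>. q 0 \<omega> \<partial>sphere_measure) has_real_derivative (\<integral>\<omega>. q' 0 \<omega> \<partial>sphere_measure)) (at (0::real))"
    by (simp only:)
  then have "(\<integral>\<omega>. q' 0 \<omega> \<partial>sphere_measure) = 0"
    using DERIV_unique DERIV_const by blast
  then show ?thesis
    by (simp add: q'_def a_def b_def)
qed

text \<open>If \<open>g t\<close> is the integral, the differential equation for \<open>g\<close>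
  says that \<open>h t = t * g t - sin t\<close> satisfies \<open>h'' = - h\<close>. Its initial
  data are zero, so it vanishes.\<close>

lemma integral_cos_component:
  "(\<integral>\<omega>. cos (t * \<omega> $ 3) \<partial>sphere_measure) = sinc t"
proof -
  define g where "g t = (\<integral>\<omega>. cos (t * \<omega> $ 3) \<partial>sphere_measure)" for t
  define g' where "g' t = (\<integral>\<omega>. - \<omega> $ 3 * sin (t * \<omega> $ 3) \<partial>sphere_measure)" for t
  define g'' where "g'' t = (\<integral>\<omega>. - (\<omega> $ 3)\<^sup>2 * cos (t * \<omega> $ 3) \<partial>sphere_measure)" for t
  have meas: "(\<lambda>\<omega>::real^3. cos (t * \<omega> $ 3)) \<in> borel_measurable borel"
    "(\<lambda>\<omega>::real^3. - \<omega> $ 3 * sin (t * \<omega> $ 3)) \<in> borel_measurable borel"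
    "(\<lambda>\<omega>::real^3. - (\<omega> $ 3)\<^sup>2 * cos (t * \<omega> $ 3)) \<in> borel_measurable borel"
    "(\<lambda>\<omega>::real^3. (\<omega> $ i)\<^sup>2 * cos (t * \<omega> $ 3)) \<in> borel_measurable borel" for t i
    by (auto intro!: borel_measurable_continuous_onI continuous_intros)
  have bd: "\<bar>\<omega> $ 3 * sin (t * \<omega> $ 3)\<bar> \<le> 1" "\<bar>(\<omega> $ i)\<^sup>2 * cos (t * \<omega> $ 3)\<bar> \<le> 1"
    "\<bar>(\<omega> $ i)^3 * sin (t * \<omega> $ 3)\<bar> \<le> 1" if "norm \<omega> = 1" for \<omega> :: "real^3" and t i
    using sphere_component_le[OF that] unfolding power2_eq_square power3_eq_cube by (auto intro!: abs_mult_le_one)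
  have int: "integrable sphere_measure (\<lambda>\<omega>. cos (t * \<omega> $ 3))"
    "integrable sphere_measure (\<lambda>\<omega>. - \<omega> $ 3 * sin (t * \<omega> $ 3))"
    "integrable sphere_measure (\<lambda>\<omega>. - (\<omega> $ 3)\<^sup>2 * cos (t * \<omega> $ 3))"
    "integrable sphere_measure (\<lambda>\<omega>. (\<omega> $ i)\<^sup>2 * cos (t * \<omega> $ 3))" for t i
    using bd by (auto intro!: integrable_sphere_bounded[of _ 1] meas)
  have g: "(g has_real_derivative g' t) (at t)" for t
    unfolding g_def g'_def
  proof (rule has_real_derivative_integral[where f'' = "\<lambda>t \<omega>. - (\<omega> $ 3)\<^sup>2 * cos (t * \<omega> $ 3)" and C = 1])
    show "finite_measure sphere_measure" by (rule S.finite_measure_axioms)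
    show "((\<lambda>t. cos (t * \<omega> $ 3)) has_real_derivative - \<omega> $ 3 * sin (t * \<omega> $ 3)) (at t)" for t and \<omega> :: "real^3"
      by (auto intro!: derivative_eq_intros)
    show "((\<lambda>t. - \<omega> $ 3 * sin (t * \<omega> $ 3)) has_real_derivative - (\<omega> $ 3)\<^sup>2 * cos (t * \<omega> $ 3)) (at t)" for t and \<omega> :: "real^3"
      by (auto intro!: derivative_eq_intros simp: power2_eq_square)
    show "\<bar>- (\<omega> $ 3)\<^sup>2 * cos (t * \<omega> $ 3)\<bar> \<le> 1" if "\<omega> \<in> space sphere_measure" for t and \<omega> :: "real^3"
      using bd(2)[of \<omega> 3 t] that by simp
  qed (rule int)+
  have g': "(g' has_real_derivative g'' t) (at t)" for t
    unfolding g'_def g''_def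
  proof (rule has_real_derivative_integral[where f'' = "\<lambda>t \<omega>. (\<omega> $ 3)^3 * sin (t * \<omega> $ 3)" and C = 1])
    show "finite_measure sphere_measure" by (rule S.finite_measure_axioms)
    show "((\<lambda>t. - (\<omega> $ 3)\<^sup>2 * cos (t * \<omega> $ 3)) has_real_derivative (\<omega> $ 3)^3 * sin (t * \<omega> $ 3)) (at t)" for t and \<omega> :: "real^3"
      by (auto intro!: derivative_eq_intros simp: power2_eq_square power3_eq_cube)
    show "((\<lambda>t. - \<omega> $ 3 * sin (t * \<omega> $ 3)) has_real_derivative - (\<omega> $ 3)\<^sup>2 * cos (t * \<omega> $ 3)) (at t)" for t and \<omega> :: "real^3"
      by (auto intro!: derivative_eq_intros simp: power2_eq_square)
    show "\<bar>(\<omega> $ 3)^3 * sin (t * \<omega> $ 3)\<bar> \<le> 1" if "\<omega> \<in> space sphere_measure" for t and \<omega> :: "real^3"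
      using bd(3)[of \<omega> 3 t] that by simp
  qed (rule int)+
  \<comment> \<open>Rotations in the planes of the coordinates \<open>1\<close>, \<open>3\<close>
    and \<open>2\<close>, \<open>3\<close> give \<open>t * A 1 = t * A 2 = - g' t\<close>. The
    squared coordinates add up to \<open>1\<close> on the sphere, so \<open>g t\<close> is
    \<open>A 1 + A 2 + A 3\<close> with \<open>A 3 = - g'' t\<close>.\<close>
  have ode: "t * g'' t + 2 * g' t + t * g t = 0" for t
  proof -
    define A where "A i = (\<integral>\<omega>. (\<omega> $ i)\<^sup>2 * cos (t * \<omega> $ 3) \<partial>sphere_measure)" for i :: 3
    have A: "t * A i + g' t = 0" if "i \<noteq> 3" for i
    proof -
      have "t * A i + g' t = (\<integral>\<omega>. t * ((\<omega> $ i)\<^sup>2 * cos (t * \<omega> $ 3)) + - \<omega> $ 3 * sin (t * \<omega> $ 3) \<partial>sphere_measure)"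
        unfolding A_def g'_def using int by (subst Bochner_Integration.integral_add) simp_all
      also have "\<dots> = 0"
        using infinitesimal_rotation[OF that, of t] by (simp add: mult.assoc)
      finally show ?thesis .
    qed
    have "g t = (\<integral>\<omega>. (\<omega> $ 1)\<^sup>2 * cos (t * \<omega> $ 3) + (\<omega> $ 2)\<^sup>2 * cos (t * \<omega> $ 3) + (\<omega> $ 3)\<^sup>2 * cos (t * \<omega> $ 3) \<partial>sphere_measure)"
      unfolding g_def
    proof (rule Bochner_Integration.integral_cong)
      fix \<omega> :: "real^3" assume "\<omega> \<in> space sphere_measure"
      then have "(\<omega> $ 1)\<^sup>2 + (\<omega> $ 2)\<^sup>2 + (\<omega> $ 3)\<^sup>2 = 1"
        by (simp add: norm_vec_def L2_set_def sum_3)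
      then show "cos (t * \<omega> $ 3) = (\<omega> $ 1)\<^sup>2 * cos (t * \<omega> $ 3) + (\<omega> $ 2)\<^sup>2 * cos (t * \<omega> $ 3) + (\<omega> $ 3)\<^sup>2 * cos (t * \<omega> $ 3)"
        by (simp flip: distrib_right)
    qed simp
    also have "\<dots> = A 1 + A 2 + A 3"
      unfolding A_def using int by simp
    also have "A 3 = - g'' t"
      by (simp add: A_def g''_def)
    finally have "t * g t = t * (A 1 + A 2 - g'' t)"
      by simp
    then show ?thesis
      using A[of 1] A[of 2] by (simp add: algebra_simps)
  qed
  define h where "h t = t * g t - sin t" for t
  define h' where "h' t = g t + t * g' t - cos t" for t
  have h: "(h has_real_derivative h' t) (at t)" for t
    unfolding h_def h'_def by (auto intro!: derivative_eq_intros g)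
  have h': "(h' has_real_derivative - h t) (at t)" for t
    unfolding h_def h'_def
    by (rule derivative_eq_intros g g' refl)+ (use ode[of t] in \<open>simp add: algebra_simps\<close>)
  \<comment> \<open>The energy of the oscillator is conserved, and it is zero at \<open>0\<close>
    because \<open>g 0 = 1\<close>.\<close>
  have "((\<lambda>t. (h t)\<^sup>2 + (h' t)\<^sup>2) has_real_derivative 0) (at t)" for t
    by (rule derivative_eq_intros h h' refl)+ simp
  then have "(h t)\<^sup>2 + (h' t)\<^sup>2 = (h 0)\<^sup>2 + (h' 0)\<^sup>2"
    using DERIV_const_ratio_const2 DERIV_isconst_all by blast
  moreover have "g 0 = 1"
    using S.prob_space by (simp add: g_def)
  ultimately have "(h t)\<^sup>2 + (h' t)\<^sup>2 = 0"
    by (simp add: h_def h'_def)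
  then have "h t = 0"
    by (simp add: sum_power2_eq_zero_iff)
  then show ?thesis
    using \<open>g 0 = 1\<close> by (auto simp: h_def sinc_def g_def field_simps)
qed

text \<open>By rotation invariance the mean depends only on the length of
  \<open>\<kappa> *\<^sub>R z\<close>, so this vector may be turned into the direction of the third
  axis. The absolute value covers negative \<kappa>.\<close>

lemma integral_plane_wave: "(\<integral>\<omega>. plane_wave \<kappa> z \<omega> \<partial>sphere_measure) = of_real (sinc (\<bar>\<kappa>\<bar> * norm z))"
proof -
  define t where "t = \<bar>\<kappa>\<bar> * norm z"
  have "norm (t *\<^sub>R axis 3 1 :: real^3) = norm (\<kappa> *\<^sub>R z)"
    by (simp add: t_def)
  then obtain T where T: "orthogonal_transformation T" "T (t *\<^sub>R axis 3 1 :: real^3) = \<kappa> *\<^sub>R z"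
    by (rule orthogonal_transformation_exists)
  define f where "f \<omega> = cis (t * \<omega> $ 3)" for \<omega> :: "real^3"
  have cont: "continuous_on UNIV f" "continuous_on UNIV (plane_wave \<kappa> z)"
    unfolding f_def plane_wave_def cis_conv_exp by (auto intro!: continuous_intros)
  have m: "f \<in> borel_measurable borel" "plane_wave \<kappa> z \<in> borel_measurable borel"
    using cont by (auto intro: borel_measurable_continuous_onI)
  have inner: "\<kappa> * (T \<omega> \<bullet> z) = t * \<omega> $ 3" for \<omega>
  proof -
    have "\<kappa> * (T \<omega> \<bullet> z) = T \<omega> \<bullet> T (t *\<^sub>R axis 3 1)"
      by (simp add: T(2))
    also have "\<dots> = \<omega> \<bullet> (t *\<^sub>R axis 3 1)"
      using T(1) by (simp add: orthogonal_transformation_def)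
    also have "\<dots> = t * \<omega> $ 3"
      by (simp add: inner_axis)
    finally show ?thesis .
  qed
  have "(\<integral>\<omega>. plane_wave \<kappa> z \<omega> \<partial>sphere_measure) = (\<integral>\<omega>. plane_wave \<kappa> z (T \<omega>) \<partial>sphere_measure)"
    using integral_sphere_orthogonal[OF T(1) m(2)] by simp
  also have "\<dots> = (\<integral>\<omega>. f \<omega> \<partial>sphere_measure)"
    by (simp only: plane_wave_def inner f_def cis_conv_exp)
  finally have eq: "(\<integral>\<omega>. plane_wave \<kappa> z \<omega> \<partial>sphere_measure) = (\<integral>\<omega>. f \<omega> \<partial>sphere_measure)" .
  have intf: "integrable sphere_measure f"
    using m by (intro integrable_sphere_bounded[of _ 1]) (simp_all add: f_def)
  \<comment> \<open>Averaging with the antipodal map cancels the odd imaginary part and leaves the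
    cosine.\<close>
  have "orthogonal_transformation (\<lambda>\<omega>::real^3. - \<omega>)"
    by (simp add: orthogonal_transformation linear_iff)
  then have "(\<integral>\<omega>. f (- \<omega>) \<partial>sphere_measure) = (\<integral>\<omega>. f \<omega> \<partial>sphere_measure)"
    by (rule integral_sphere_orthogonal) (rule m)
  moreover have "integrable sphere_measure (\<lambda>\<omega>. f (- \<omega>))"
  proof (rule integrable_sphere_bounded)
    show "(\<lambda>\<omega>. f (- \<omega>)) \<in> borel_measurable borel"
      using cont(1) by (intro borel_measurable_continuous_onI continuous_on_compose2[OF cont(1)] continuous_intros) simp
    show "norm (f (- \<omega>)) \<le> 1" for \<omega>
      by (simp add: f_def)
  qed
  ultimately have "(\<integral>\<omega>. f \<omega> \<partial>sphere_measure) = (\<integral>\<omega>. f \<omega> + f (- \<omega>) \<partial>sphere_measure) / 2"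
    using intf by (simp add: Bochner_Integration.integral_add)
  also have "(\<lambda>\<omega>. f \<omega> + f (- \<omega>)) = (\<lambda>\<omega>. of_real (2 * cos (t * \<omega> $ 3)))"
    by (simp add: f_def fun_eq_iff complex_eq_iff)
  also have "(\<integral>\<omega>. complex_of_real (2 * cos (t * \<omega> $ 3)) \<partial>sphere_measure) / 2 = of_real (sinc t)"
    by (simp only: integral_complex_of_real Bochner_Integration.integral_mult_right_zero integral_cos_component) simp
  finally show ?thesis
    using eq by (simp add: t_def)
qed

section \<open>The function sinc and separated points\<close>

lemma sinc_le_inverse: "0 < t \<Longrightarrow> \<bar>sinc t\<bar> \<le> 1 / t"
  by (simp add: sinc_def divide_right_mono)

lemma sinc_ge: "0 \<le> t \<Longrightarrow> 1 - t\<^sup>2 / 6 \<le> sinc t"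
proof -
  assume t: "0 \<le> t"
  have "{..<3::nat} = {0, 1, 2}"
    by auto
  then have "\<bar>sin t - t\<bar> \<le> t ^ 3 / 6"
    using Maclaurin_sin_bound[of t 3] t by (simp add: sin_coeff_def fact_numeral)
  then have "t - t ^ 3 / 6 \<le> sin t"
    by linarith
  then have "t * (1 - t\<^sup>2 / 6) \<le> sin t"
    by (simp add: power2_eq_square power3_eq_cube algebra_simps)
  then show ?thesis
    using t by (auto simp: sinc_def field_simps)
qed

lemma sinc_le: "0 \<le> t \<Longrightarrow> sinc t \<le> 1 - t\<^sup>2 / 6 + t ^ 4 / 120"
proof -
  assume t: "0 \<le> t"
  have "{..<5::nat} = {0, 1, 2, 3, 4}"
    by auto
  then have "\<bar>sin t - (t - t ^ 3 / 6)\<bar> \<le> t ^ 5 / 120"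
    using Maclaurin_sin_bound[of t 5] t by (simp add: sin_coeff_def fact_numeral)
  then have "sin t \<le> t - t ^ 3 / 6 + t ^ 5 / 120"
    by linarith
  then have "sin t \<le> t * (1 - t\<^sup>2 / 6 + t ^ 4 / 120)"
    by (simp add: eval_nat_numeral algebra_simps)
  then show ?thesis
    using t by (auto simp: sinc_def field_simps)
qed

lemma abs_sinc_le_one: "\<bar>sinc t\<bar> \<le> 1"
  using abs_sin_x_le_abs_x[of t] by (simp add: sinc_def)

lemma DERIV_sinc:
  assumes "t \<noteq> 0"
  shows "(sinc has_real_derivative (t * cos t - sin t) / t\<^sup>2) (at t)"
proof -
  have "((\<lambda>t. sin t / t) has_real_derivative (t * cos t - sin t) / t\<^sup>2) (at t)"
    using assms by (auto intro!: derivative_eq_intros simp: power2_eq_square field_simps)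
  moreover have "\<forall>\<^sub>F u in nhds t. sin u / u = sinc u"
    using t1_space_nhds[OF assms] by (rule eventually_mono) (simp add: sinc_def)
  ultimately show ?thesis
    by (subst (asm) DERIV_cong_ev[OF refl _ refl]) auto
qed

text \<open>The quotient is the absolute value of \<open>cos t - sinc t\<close>, hence at most
  \<open>2\<close>. Boundedness makes \<open>c_nu\<close> a genuine supremum.\<close>

lemma c_nu_bdd_above: "bdd_above ((\<lambda>t::real. \<bar>t * cos t - sin t\<bar> / t) ` {0<..})"
proof (rule bdd_aboveI2)
  fix t :: real assume "t \<in> {0<..}"
  then have "0 < t"
    by simp
  then have 1: "\<bar>t * cos t - sin t\<bar> / t = \<bar>(t * cos t - sin t) / t\<bar>"
    by simp
  have 2: "(t * cos t - sin t) / t = cos t - sinc t"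
    using \<open>0 < t\<close> by (simp add: sinc_def diff_divide_distrib)
  show "\<bar>t * cos t - sin t\<bar> / t \<le> 2"
    unfolding 1 2 using abs_sinc_le_one[of t] abs_cos_le_one[of t] by linarith
qed

lemma c_nu_ge: "0 < t \<Longrightarrow> \<bar>t * cos t - sin t\<bar> / t \<le> c_nu"
  unfolding c_nu_def by (rule cSUP_upper[OF _ c_nu_bdd_above]) simp

text \<open>The quotient equals \<open>1\<close> at \<open>pi\<close>. Hence \<open>c_nu / t\<close>
  dominates the values of sinc as well as its derivative, and one sum controls both.\<close>

lemma one_le_c_nu: "1 \<le> c_nu"
  using c_nu_ge[of pi] by simp

lemma deriv_sinc_le:
  assumes "0 < t"
  shows "\<bar>(t * cos t - sin t) / t\<^sup>2\<bar> \<le> c_nu / t"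
proof -
  have "\<bar>(t * cos t - sin t) / t\<^sup>2\<bar> = \<bar>t * cos t - sin t\<bar> / t / t"
    using assms by (simp add: power2_eq_square abs_mult)
  also have "\<dots> \<le> c_nu / t"
    using c_nu_ge[OF assms] assms by (intro divide_right_mono) simp_all
  finally show ?thesis .
qed

lemma sinc_squared_le_b_const:
  assumes "0 < \<gamma>" "\<gamma> \<le> t"
  shows "(sinc t)\<^sup>2 \<le> 1 - b_const \<gamma>"
proof -
  have "bdd_above ((\<lambda>t. (sin t / t)\<^sup>2) ` {\<gamma>..})"
  proof (rule bdd_aboveI2)
    fix u assume "u \<in> {\<gamma>..}"
    then have "sin u / u = sinc u"
      using assms by (simp add: sinc_def)
    then show "(sin u / u)\<^sup>2 \<le> 1"
      using abs_sinc_le_one[of u] by (simp add: abs_square_le_1)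
  qed
  then have "(sin t / t)\<^sup>2 \<le> (SUP t \<in> {\<gamma>..}. (sin t / t)\<^sup>2)"
    using assms by (intro cSUP_upper) simp_all
  then show ?thesis
    using assms by (simp add: b_const_def sinc_def)
qed

lemma b_const_le_one: "0 < \<gamma> \<Longrightarrow> b_const \<gamma> \<le> 1"
  using sinc_squared_le_b_const[of \<gamma> \<gamma>] zero_le_power2[of "sinc \<gamma>"] by linarith

section \<open>Counting separated points by volume\<close>

text \<open>Induction removing a point \<open>y\<close> with the largest \<open>d y\<close>. Its
  rank is \<open>card S\<close>, which pays for the last summand; the ranks of the other points can
  only drop, and this relaxes their bounds because \<open>h\<close> is decreasing.\<close>

lemma sum_le_sum_rank:
  fixes f :: "'a \<Rightarrow> real" and d :: "'a \<Rightarrow> real"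
  assumes "finite S" and "antimono h"
    and "\<And>y. y \<in> S \<Longrightarrow> f y \<le> h (card {w \<in> S. d w \<le> d y})"
  shows "sum f S \<le> (\<Sum>k=1..card S. h k)"
  using assms(1,3)
proof (induction "card S" arbitrary: S)
  case 0
  then show ?case by simp
next
  case (Suc n)
  then have ne: "S \<noteq> {}"
    by auto
  have "Max (d ` S) \<in> d ` S"
    using Suc.prems(1) ne by (intro Max_in) auto
  then obtain y where "y \<in> S" "Max (d ` S) = d y"
    by auto
  then have y: "y \<in> S" "\<And>w. w \<in> S \<Longrightarrow> d w \<le> d y"
    using Suc.prems(1) by (auto intro: Max_ge simp flip: \<open>Max (d ` S) = d y\<close>)
  have card: "card (S - {y}) = n"
    using Suc y by simp
  have "sum f (S - {y}) \<le> (\<Sum>k=1..card (S - {y}). h k)"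
  proof (rule Suc.hyps(1))
    fix w assume w: "w \<in> S - {y}"
    have "f w \<le> h (card {v \<in> S. d v \<le> d w})"
      using w Suc.prems by auto
    also have "\<dots> \<le> h (card {v \<in> S - {y}. d v \<le> d w})"
      using Suc.prems(1) by (intro antimonoD[OF assms(2)] card_mono) auto
    finally show "f w \<le> h (card {v \<in> S - {y}. d v \<le> d w})" .
  qed (use card Suc.prems in auto)
  moreover have "{w \<in> S. d w \<le> d y} = S"
    using y by auto
  then have "f y \<le> h (Suc n)"
    using Suc.prems(2)[OF y(1)] Suc.hyps(2) by simp
  ultimately show ?case
    using sum.remove[OF Suc.prems(1) y(1), of f] card by (simp flip: Suc.hyps(2))
qed

text \<open>The balls of radius \<open>\<delta> / 2\<close> around the points are disjoint and lie
  in the ball of radius \<open>r + \<delta> / 2\<close> around \<open>z\<close>; volumes are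
  compared.\<close>

lemma card_packing:
  fixes X :: "(real^3) set"
  assumes "finite X" "0 < \<delta>" "0 \<le> r"
    and sep: "\<And>x y. x \<in> X \<Longrightarrow> y \<in> X \<Longrightarrow> x \<noteq> y \<Longrightarrow> \<delta> \<le> norm (x - y)"
    and r: "\<And>x. x \<in> X \<Longrightarrow> norm (z - x) \<le> r"
  shows "real (card X) * (\<delta> / 2) ^ 3 \<le> (r + \<delta> / 2) ^ 3"
proof -
  define v where "v = measure lborel (ball (0::real^3) 1)"
  have v: "0 < v"
    unfolding v_def by (simp add: content_ball_pos)
  have vol: "measure lborel (ball c t) = t ^ 3 * v" if "0 \<le> t" for c :: "real^3" and t
    using content_ball_conv_unit_ball[OF that, of c] by (simp add: v_def)
  have fm: "ball c t \<in> fmeasurable lborel" for c :: "real^3" and t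
    using emeasure_lborel_ball_finite[of c t] by (intro fmeasurableI) simp_all
  have "disjoint_family_on (\<lambda>x. ball x (\<delta> / 2)) X"
    unfolding disjoint_family_on_def
  proof (intro ballI impI)
    fix x y assume "x \<in> X" "y \<in> X" "x \<noteq> y"
    then have "\<delta> / 2 + \<delta> / 2 \<le> dist x y"
      using sep by (simp add: dist_norm)
    then show "ball x (\<delta> / 2) \<inter> ball y (\<delta> / 2) = {}"
      by (rule disjoint_ballI)
  qed
  then have "measure lborel (\<Union>x\<in>X. ball x (\<delta> / 2)) = (\<Sum>x\<in>X. measure lborel (ball x (\<delta> / 2)))"
    using fm assms(1) by (intro measure_finite_Union) (auto simp: fmeasurable_def less_top)
  also have "\<dots> = real (card X) * ((\<delta> / 2) ^ 3 * v)"
    using assms(2) by (simp add: vol)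
  finally have "real (card X) * ((\<delta> / 2) ^ 3 * v) = measure lborel (\<Union>x\<in>X. ball x (\<delta> / 2))" ..
  also have "\<dots> \<le> measure lborel (ball z (r + \<delta> / 2))"
  proof (rule measure_mono_fmeasurable[OF _ _ fm])
    show "(\<Union>x\<in>X. ball x (\<delta> / 2)) \<subseteq> ball z (r + \<delta> / 2)"
    proof (clarsimp)
      fix x w assume "x \<in> X" and w: "dist x w * 2 < \<delta>"
      have "dist z w \<le> dist z x + dist x w"
        by (rule dist_triangle)
      then show "dist z w < r + \<delta> / 2"
        using r[OF \<open>x \<in> X\<close>] w by (simp add: dist_norm)
    qed
    show "(\<Union>x\<in>X. ball x (\<delta> / 2)) \<in> sets lborel"
      using assms(1) by (intro sets.finite_UN) simp_all
  qed
  also have "\<dots> = (r + \<delta> / 2) ^ 3 * v"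
    using assms by (intro vol) simp
  finally show ?thesis
    using v by simp
qed

text \<open>Discrete form of integrating the powers -1/3 and -2/3, which have the antiderivatives
  3/2 times the power 2/3 and 3 times the power 1/3. For the two cube roots \<open>a\<close> and
  \<open>b\<close> it follows from
  \<open>(a - b) * (a\<^sup>2 + a * b + b\<^sup>2) = 1\<close>.\<close>

lemma inverse_root3_le_diff:
  fixes k :: nat
  assumes "k \<ge> 1"
  shows "1 / root 3 (real (k + 1)) \<le> 3 / 2 * ((root 3 (real (k + 1)))\<^sup>2 - (root 3 (real k))\<^sup>2)"
    and "1 / (root 3 (real (k + 1)))\<^sup>2 \<le> 3 * (root 3 (real (k + 1)) - root 3 (real k))"
proof -
  define a b where "a = root 3 (real (k + 1))" and "b = root 3 (real k)"
  have a: "0 < a" "0 < b" "b \<le> a" and ab: "a ^ 3 = real (k + 1)" "b ^ 3 = real k"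
    using assms by (simp_all add: a_def b_def)
  have prod: "(a - b) * (a\<^sup>2 + a * b + b\<^sup>2) = 1"
    using ab by (simp add: power2_eq_square power3_eq_cube algebra_simps)
  have "b * b \<le> a * b" "b * b \<le> a * a" "a * b \<le> a * a"
    using a by (auto intro: mult_mono)
  then have le: "2 * (a\<^sup>2 + a * b + b\<^sup>2) \<le> 3 * (a + b) * a" "a\<^sup>2 + a * b + b\<^sup>2 \<le> 3 * a\<^sup>2"
    by (auto simp: power2_eq_square algebra_simps)
  have "2 \<le> (a - b) * (3 * (a + b) * a)" "1 \<le> (a - b) * (3 * a\<^sup>2)"
    using mult_left_mono[OF le(1), of "a - b"] mult_left_mono[OF le(2), of "a - b"] a prod
    unfolding mult.left_commute[of "a - b" 2 "_ + _"] by linarith+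
  then show "1 / a \<le> 3 / 2 * (a\<^sup>2 - b\<^sup>2)" "1 / a\<^sup>2 \<le> 3 * (a - b)"
    using a by (simp_all add: field_simps power2_eq_square)
qed

text \<open>Telescoping. The argument \<open>k + 1\<close> occurs because the nearest point is set
  aside: rank \<open>k\<close> among the remaining points is rank \<open>k + 1\<close> among
  all.\<close>

lemma sum_inverse_root3_le:
  "(\<Sum>k=1..n. 1 / root 3 (real (k + 1))) \<le> 3 / 2 * (root 3 (real (n + 1)))\<^sup>2"
  "(\<Sum>k=1..n. 1 / (root 3 (real (k + 1)))\<^sup>2) \<le> 3 * root 3 (real (n + 1))"
proof (induction n)
  case (Suc n)
  {
    case 1
    show ?case using Suc(1) inverse_root3_le_diff(1)[of "n + 1"] by simp
  next
    case 2
    show ?case using Suc(2) inverse_root3_le_diff(2)[of "n + 1"] by simp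
  }
qed simp_all

text \<open>Ordering the points by distance from \<open>z\<close>, the volume count forces the
  distances to grow like the cube root of the rank, which reduces both sums to the telescoping ones.
  The factor \<open>K\<close> absorbs the margin \<open>\<delta> / 2\<close>: it is
  \<open>3 / 2\<close> when all distances are at least \<delta>, and \<open>2\<close> when they are
  at least \<open>\<delta> / 2\<close>.\<close>

lemma packing_sums:
  fixes X :: "(real^3) set"
  assumes X: "finite X" "0 < \<delta>" "x0 \<in> X"
    and sep: "\<And>x y. x \<in> X \<Longrightarrow> y \<in> X \<Longrightarrow> x \<noteq> y \<Longrightarrow> \<delta> \<le> norm (x - y)"
    and near: "\<And>y. y \<in> X - {x0} \<Longrightarrow> norm (z - x0) \<le> norm (z - y)"
    and K: "\<And>y. y \<in> X - {x0} \<Longrightarrow> norm (z - y) + \<delta> / 2 \<le> K * norm (z - y)" "0 \<le> K"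
  shows "(\<Sum>y\<in>X - {x0}. 1 / norm (z - y)) \<le> 2 * K / \<delta> * (3 / 2 * (root 3 (card X))\<^sup>2)"
    and "(\<Sum>y\<in>X - {x0}. 1 / (norm (z - y))\<^sup>2) \<le> (2 * K / \<delta>)\<^sup>2 * (3 * root 3 (card X))"
proof -
  define N where "N y = card {w \<in> X - {x0}. norm (z - w) \<le> norm (z - y)}" for y
  have pos: "0 < norm (z - y)" if "y \<in> X - {x0}" for y
  proof (rule ccontr)
    assume "\<not> 0 < norm (z - y)"
    then have "norm (z - y) = 0"
      by simp
    with K(1)[OF that] X(2) show False
      by simp
  qed
  have bound: "1 / norm (z - y) \<le> 2 * K / \<delta> * (1 / root 3 (real (N y + 1)))" if y: "y \<in> X - {x0}" for y
  proof -
    let ?r = "norm (z - y)"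
    \<comment> \<open>By \<open>near\<close>, the point \<open>x0\<close> also lies within
      \<open>?r\<close> of \<open>z\<close>; adding it to the points counted by \<open>N y\<close>
      gives \<open>N y + 1\<close>.\<close>
    let ?Z = "insert x0 {w \<in> X - {x0}. norm (z - w) \<le> norm (z - y)}"
    have "real (card ?Z) * (\<delta> / 2) ^ 3 \<le> (?r + \<delta> / 2) ^ 3"
      by (rule card_packing[where z = z]) (use X sep near[OF y] in auto)
    moreover have "card ?Z = N y + 1"
      using X by (simp add: N_def)
    moreover have "(?r + \<delta> / 2) ^ 3 \<le> (K * ?r) ^ 3"
      using K(1)[OF y] X(2) by (intro power_mono) simp_all
    ultimately have "real (N y + 1) * (\<delta> / 2) ^ 3 \<le> (K * ?r) ^ 3"
      by simp
    then have "root 3 (real (N y + 1) * (\<delta> / 2) ^ 3) \<le> root 3 ((K * ?r) ^ 3)"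
      by simp
    then have "root 3 (real (N y + 1)) * (\<delta> / 2) \<le> K * ?r"
      using X(2) K(2) by (simp add: real_root_mult real_root_power_cancel)
    moreover have "0 < root 3 (real (N y + 1))"
      by simp
    ultimately show ?thesis
      using pos[OF y] X(2) by (simp add: field_simps)
  qed
  have card: "card (X - {x0}) + 1 = card X"
    using X card_Suc_Diff1 by fastforce
  have anti: "antimono (\<lambda>k. 2 * K / \<delta> * (1 / root 3 (real (k + 1))))"
    "antimono (\<lambda>k. (2 * K / \<delta>)\<^sup>2 * (1 / (root 3 (real (k + 1)))\<^sup>2))"
    using X(2) K(2) by (auto intro!: antimonoI mult_left_mono divide_left_mono power_mono mult_pos_pos zero_less_power)
  have "(\<Sum>y\<in>X - {x0}. 1 / norm (z - y)) \<le> (\<Sum>k=1..card (X - {x0}). 2 * K / \<delta> * (1 / root 3 (real (k + 1))))"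
    using X bound unfolding N_def
    by (intro sum_le_sum_rank[OF _ anti(1), where d = "\<lambda>y. norm (z - y)"]) simp_all
  also have "\<dots> = 2 * K / \<delta> * (\<Sum>k=1..card (X - {x0}). 1 / root 3 (real (k + 1)))"
    by (rule sum_distrib_left[symmetric])
  also have "\<dots> \<le> 2 * K / \<delta> * (3 / 2 * (root 3 (real (card (X - {x0}) + 1)))\<^sup>2)"
    using X(2) K(2) by (intro mult_left_mono sum_inverse_root3_le) simp_all
  finally show "(\<Sum>y\<in>X - {x0}. 1 / norm (z - y)) \<le> 2 * K / \<delta> * (3 / 2 * (root 3 (card X))\<^sup>2)"
    by (simp only: card)
  have bound2: "1 / (norm (z - y))\<^sup>2 \<le> (2 * K / \<delta>)\<^sup>2 * (1 / (root 3 (real (N y + 1)))\<^sup>2)" if y: "y \<in> X - {x0}" for y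
    using power_mono[OF bound[OF y], of 2] by (simp add: power_mult_distrib power_divide)
  have "(\<Sum>y\<in>X - {x0}. 1 / (norm (z - y))\<^sup>2)
      \<le> (\<Sum>k=1..card (X - {x0}). (2 * K / \<delta>)\<^sup>2 * (1 / (root 3 (real (k + 1)))\<^sup>2))"
    using X bound2 unfolding N_def
    by (intro sum_le_sum_rank[OF _ anti(2), where d = "\<lambda>y. norm (z - y)"]) simp_all
  also have "\<dots> = (2 * K / \<delta>)\<^sup>2 * (\<Sum>k=1..card (X - {x0}). 1 / (root 3 (real (k + 1)))\<^sup>2)"
    by (rule sum_distrib_left[symmetric])
  also have "\<dots> \<le> (2 * K / \<delta>)\<^sup>2 * (3 * root 3 (real (card (X - {x0}) + 1)))"
    using X(2) K(2) by (intro mult_left_mono sum_inverse_root3_le) simp_all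
  finally show "(\<Sum>y\<in>X - {x0}. 1 / (norm (z - y))\<^sup>2) \<le> (2 * K / \<delta>)\<^sup>2 * (3 * root 3 (card X))"
    by (simp only: card)
qed

section \<open>Plane waves in the Hilbert space of the sphere\<close>

lemma L2_measurable: "f \<in> L2 \<Longrightarrow> f \<in> borel_measurable sphere_measure"
  by (simp add: L2_def)

lemma L2_integrable_mult:
  assumes "f \<in> L2" "g \<in> L2"
  shows "integrable sphere_measure (\<lambda>\<omega>. f \<omega> * cnj (g \<omega>))"
proof (rule Bochner_Integration.integrable_bound)
  show "integrable sphere_measure (\<lambda>\<omega>. (cmod (f \<omega>))\<^sup>2 + (cmod (g \<omega>))\<^sup>2)"
    using assms by (simp add: L2_def)
  have [measurable]: "f \<in> borel_measurable sphere_measure" "g \<in> borel_measurable sphere_measure"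
    using assms by (simp_all add: L2_def)
  have [measurable]: "cnj \<in> borel_measurable borel"
    by (intro borel_measurable_continuous_onI continuous_intros)
  show "(\<lambda>\<omega>. f \<omega> * cnj (g \<omega>)) \<in> borel_measurable sphere_measure"
    by measurable
  have "a * b \<le> a\<^sup>2 + b\<^sup>2" if "0 \<le> a" "0 \<le> b" for a b :: real
    using sum_squares_bound[of a b] mult_nonneg_nonneg[OF that] by linarith
  then show "AE \<omega> in sphere_measure. norm (f \<omega> * cnj (g \<omega>)) \<le> norm ((cmod (f \<omega>))\<^sup>2 + (cmod (g \<omega>))\<^sup>2)"
    by (simp add: norm_mult)
qed

lemma L2_add: "(\<lambda>\<omega>. f \<omega> + g \<omega>) \<in> L2" if "f \<in> L2" "g \<in> L2"
proof -
  have [measurable]: "f \<in> borel_measurable sphere_measure" "g \<in> borel_measurable sphere_measure"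
    using that by (simp_all add: L2_def)
  have "integrable sphere_measure (\<lambda>\<omega>. (cmod (f \<omega> + g \<omega>))\<^sup>2)"
  proof (rule Bochner_Integration.integrable_bound)
    show "integrable sphere_measure (\<lambda>\<omega>. 2 * (cmod (f \<omega>))\<^sup>2 + 2 * (cmod (g \<omega>))\<^sup>2)"
      using that by (simp add: L2_def)
    have "(cmod (a + b))\<^sup>2 \<le> 2 * (cmod a)\<^sup>2 + 2 * (cmod b)\<^sup>2" for a b
    proof -
      have "(cmod (a + b))\<^sup>2 \<le> (cmod a + cmod b)\<^sup>2"
        by (intro power_mono norm_triangle_ineq) simp
      also have "\<dots> \<le> 2 * (cmod a)\<^sup>2 + 2 * (cmod b)\<^sup>2"
        using sum_squares_bound[of "cmod a" "cmod b"] by (simp add: power2_sum)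
      finally show ?thesis .
    qed
    then show "AE \<omega> in sphere_measure. norm ((cmod (f \<omega> + g \<omega>))\<^sup>2) \<le> norm (2 * (cmod (f \<omega>))\<^sup>2 + 2 * (cmod (g \<omega>))\<^sup>2)"
      by simp
  qed simp
  then show ?thesis
    by (simp add: L2_def)
qed

lemma L2_cmult: "(\<lambda>\<omega>. c * f \<omega>) \<in> L2" if "f \<in> L2"
proof -
  have [measurable]: "f \<in> borel_measurable sphere_measure"
    using that by (rule L2_measurable)
  have "(\<lambda>\<omega>. c * f \<omega>) \<in> borel_measurable sphere_measure"
    by measurable
  then show ?thesis
    using that by (simp add: L2_def norm_mult power_mult_distrib)
qed

lemma L2_diff: "(\<lambda>\<omega>. f \<omega> - g \<omega>) \<in> L2" if "f \<in> L2" "g \<in> L2"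
  using L2_add[OF that(1) L2_cmult[OF that(2), of "-1"]] by simp

lemma L2_zero: "(\<lambda>\<omega>. 0) \<in> L2"
  by (simp add: L2_def)

lemma L2_sum: "(\<And>i. i \<in> I \<Longrightarrow> f i \<in> L2) \<Longrightarrow> (\<lambda>\<omega>. \<Sum>i\<in>I. f i \<omega>) \<in> L2"
  by (induction I rule: infinite_finite_induct) (simp_all add: L2_zero L2_add)

lemma l2_inner_add_left:
  "f \<in> L2 \<Longrightarrow> g \<in> L2 \<Longrightarrow> h \<in> L2 \<Longrightarrow> l2_inner (\<lambda>\<omega>. f \<omega> + g \<omega>) h = l2_inner f h + l2_inner g h"
  by (simp add: l2_inner_def distrib_right L2_integrable_mult)

lemma l2_inner_diff_left:
  "f \<in> L2 \<Longrightarrow> g \<in> L2 \<Longrightarrow> h \<in> L2 \<Longrightarrow> l2_inner (\<lambda>\<omega>. f \<omega> - g \<omega>) h = l2_inner f h - l2_inner g h"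
  by (simp add: l2_inner_def left_diff_distrib L2_integrable_mult)

lemma l2_inner_cmult_left: "l2_inner (\<lambda>\<omega>. c * f \<omega>) h = c * l2_inner f h"
  by (simp add: l2_inner_def mult.assoc)

lemma l2_inner_commute: "l2_inner g f = cnj (l2_inner f g)"
proof -
  have "cnj (l2_inner f g) = (\<integral>\<omega>. cnj (f \<omega> * cnj (g \<omega>)) \<partial>sphere_measure)"
    unfolding l2_inner_def by (rule Bochner_Integration.integral_cnj[symmetric])
  also have "\<dots> = l2_inner g f"
    by (simp add: l2_inner_def mult.commute)
  finally show ?thesis ..
qed

lemma l2_inner_add_right:
  "f \<in> L2 \<Longrightarrow> g \<in> L2 \<Longrightarrow> h \<in> L2 \<Longrightarrow> l2_inner h (\<lambda>\<omega>. f \<omega> + g \<omega>) = l2_inner h f + l2_inner h g"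
  using l2_inner_add_left[of f g h] by (subst (1 2 3) l2_inner_commute) simp

lemma l2_inner_diff_right:
  "f \<in> L2 \<Longrightarrow> g \<in> L2 \<Longrightarrow> h \<in> L2 \<Longrightarrow> l2_inner h (\<lambda>\<omega>. f \<omega> - g \<omega>) = l2_inner h f - l2_inner h g"
  using l2_inner_diff_left[of f g h] by (subst (1 2 3) l2_inner_commute) simp

lemma l2_inner_cmult_right: "l2_inner h (\<lambda>\<omega>. c * f \<omega>) = cnj c * l2_inner h f"
  using l2_inner_cmult_left[of c f h] by (subst (1 2) l2_inner_commute) simp

lemma l2_inner_sum_left:
  assumes "\<And>i. i \<in> I \<Longrightarrow> f i \<in> L2" "h \<in> L2"
  shows "l2_inner (\<lambda>\<omega>. \<Sum>i\<in>I. f i \<omega>) h = (\<Sum>i\<in>I. l2_inner (f i) h)"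
  using assms
  by (induction I rule: infinite_finite_induct)
     (simp_all add: l2_inner_add_left L2_sum, simp_all add: l2_inner_def)

lemma l2_inner_sum_right:
  assumes "\<And>i. i \<in> I \<Longrightarrow> f i \<in> L2" "h \<in> L2"
  shows "l2_inner h (\<lambda>\<omega>. \<Sum>i\<in>I. f i \<omega>) = (\<Sum>i\<in>I. l2_inner h (f i))"
proof -
  have "l2_inner h (\<lambda>\<omega>. \<Sum>i\<in>I. f i \<omega>) = cnj (\<Sum>i\<in>I. l2_inner (f i) h)"
    unfolding l2_inner_commute[of h] by (intro arg_cong[of _ _ cnj] l2_inner_sum_left assms)
  also have "\<dots> = (\<Sum>i\<in>I. l2_inner h (f i))"
    by (simp add: l2_inner_commute[of h])
  finally show ?thesis .
qed

lemma l2_norm_nonneg: "0 \<le> l2_norm f"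
  by (simp add: l2_norm_def)

lemma l2_norm_power2: "(l2_norm f)\<^sup>2 = (\<integral>\<omega>. (cmod (f \<omega>))\<^sup>2 \<partial>sphere_measure)"
  by (simp add: l2_norm_def)

lemma l2_inner_self: "l2_inner f f = of_real ((l2_norm f)\<^sup>2)"
  unfolding l2_inner_def l2_norm_power2 integral_complex_of_real[symmetric]
  by (simp only: complex_norm_square)

lemma l2_norm_power2_Re: "(l2_norm f)\<^sup>2 = Re (l2_inner f f)"
  by (simp add: l2_inner_self)

lemma l2_norm_cmult: "l2_norm (\<lambda>\<omega>. c * f \<omega>) = cmod c * l2_norm f"
  by (simp add: l2_norm_def norm_mult power_mult_distrib real_sqrt_mult)

lemma l2_norm_diff_commute: "l2_norm (\<lambda>\<omega>. f \<omega> - g \<omega>) = l2_norm (\<lambda>\<omega>. g \<omega> - f \<omega>)"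
  by (simp add: l2_norm_def norm_minus_commute)

lemma l2_norm_add_power2:
  assumes "f \<in> L2" "g \<in> L2"
  shows "(l2_norm (\<lambda>\<omega>. f \<omega> + g \<omega>))\<^sup>2 = (l2_norm f)\<^sup>2 + (l2_norm g)\<^sup>2 + 2 * Re (l2_inner f g)"
  using assms l2_inner_commute[of g f]
  by (simp add: l2_norm_power2_Re l2_inner_add_left l2_inner_add_right L2_add)

lemma l2_norm_diff_power2:
  assumes "f \<in> L2" "g \<in> L2"
  shows "(l2_norm (\<lambda>\<omega>. f \<omega> - g \<omega>))\<^sup>2 = (l2_norm f)\<^sup>2 + (l2_norm g)\<^sup>2 - 2 * Re (l2_inner f g)"
  using assms l2_inner_commute[of g f]
  by (simp add: l2_norm_power2_Re l2_inner_diff_left l2_inner_diff_right L2_diff)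

lemma l2_Cauchy_Schwarz:
  assumes "f \<in> L2" "g \<in> L2"
  shows "cmod (l2_inner f g) \<le> l2_norm f * l2_norm g"
proof -
  define w where "w = cmod (l2_inner f g)"
  \<comment> \<open>A unimodular factor makes the inner product real and nonnegative, so that a real
    parameter suffices in the quadratic inequality.\<close>
  obtain u where u: "cmod u = 1" "u * l2_inner f g = of_real w"
  proof (cases "l2_inner f g = 0")
    case False
    then show ?thesis
      by (intro that[of "of_real w / l2_inner f g"]) (simp_all add: w_def norm_divide)
  qed (auto intro: that[of 1] simp: w_def)
  have quad: "2 * r * w \<le> (l2_norm f)\<^sup>2 + r\<^sup>2 * (l2_norm g)\<^sup>2" for r :: real
  proof -
    have "l2_inner (\<lambda>\<omega>. u * f \<omega>) (\<lambda>\<omega>. of_real r * g \<omega>) = of_real r * (u * l2_inner f g)"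
      by (simp add: l2_inner_cmult_left l2_inner_cmult_right)
    then have inner: "Re (l2_inner (\<lambda>\<omega>. u * f \<omega>) (\<lambda>\<omega>. of_real r * g \<omega>)) = r * w"
      by (simp only: u(2) of_real_mult[symmetric] Re_complex_of_real)
    have "0 \<le> (l2_norm (\<lambda>\<omega>. u * f \<omega> - of_real r * g \<omega>))\<^sup>2"
      by simp
    also have "\<dots> = (l2_norm f)\<^sup>2 + r\<^sup>2 * (l2_norm g)\<^sup>2 - 2 * r * w"
      using assms u(1) inner
      by (simp add: l2_norm_diff_power2 L2_cmult l2_norm_cmult power_mult_distrib)
    finally show ?thesis
      by simp
  qed
  have "w\<^sup>2 \<le> (l2_norm f)\<^sup>2 * (l2_norm g)\<^sup>2"
  proof (cases "l2_norm g = 0")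
    \<comment> \<open>Since \<open>l2_norm\<close> is only a seminorm, \<open>g\<close> need not be
      zero here; a large parameter in the quadratic inequality still forces
      \<open>w = 0\<close>.\<close>
    case True
    have "w = 0"
    proof (rule ccontr)
      assume "w \<noteq> 0"
      then show False
        using quad[of "((l2_norm f)\<^sup>2 + 1) / (2 * w)"] True by simp
    qed
    then show ?thesis by simp
  next
    case False
    show ?thesis
    proof -
      let ?N = "(l2_norm g)\<^sup>2"
      have "0 < ?N"
        using False by simp
      have "w\<^sup>2 / ?N \<le> (l2_norm f)\<^sup>2"
        using quad[of "w / ?N"] False by (simp add: power2_eq_square)
      then show ?thesis
        using \<open>0 < ?N\<close> by (simp add: pos_divide_le_eq)
    qed
  qed
  then show ?thesis
    unfolding w_def[symmetric] power_mult_distrib[symmetric]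
    by (rule power2_le_imp_le) (simp add: l2_norm_nonneg)
qed

lemma l2_triangle:
  assumes "f \<in> L2" "g \<in> L2"
  shows "l2_norm (\<lambda>\<omega>. f \<omega> + g \<omega>) \<le> l2_norm f + l2_norm g"
proof (rule power2_le_imp_le)
  have "Re (l2_inner f g) \<le> l2_norm f * l2_norm g"
    using l2_Cauchy_Schwarz[OF assms] complex_Re_le_cmod[of "l2_inner f g"] by linarith
  then show "(l2_norm (\<lambda>\<omega>. f \<omega> + g \<omega>))\<^sup>2 \<le> (l2_norm f + l2_norm g)\<^sup>2"
    using assms by (simp add: l2_norm_add_power2 power2_sum)
qed (simp add: l2_norm_nonneg)

lemma l2_norm_sum:
  assumes "\<And>i. i \<in> I \<Longrightarrow> f i \<in> L2"
  shows "l2_norm (\<lambda>\<omega>. \<Sum>i\<in>I. f i \<omega>) \<le> (\<Sum>i\<in>I. l2_norm (f i))"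
  using assms
proof (induction I rule: infinite_finite_induct)
  case (insert i I)
  have "l2_norm (\<lambda>\<omega>. f i \<omega> + (\<Sum>i\<in>I. f i \<omega>)) \<le> l2_norm (f i) + l2_norm (\<lambda>\<omega>. \<Sum>i\<in>I. f i \<omega>)"
    using insert by (intro l2_triangle L2_sum) auto
  then show ?case
    using insert by simp
qed (simp_all add: l2_norm_def)

section \<open>Orthogonal projection onto spans of plane waves\<close>

text \<open>One Gram-Schmidt step per index: \<open>r\<close> is the component of the new vector
  orthogonal to the earlier ones, and a multiple of it corrects the residual \<open>g\<close>.
  Linear independence is not assumed.\<close>

lemma orthogonal_coefficients_exist:
  assumes "finite I" "\<And>i. i \<in> I \<Longrightarrow> e i \<in> L2" "f \<in> L2"
  shows "\<exists>a. \<forall>i\<in>I. l2_inner (\<lambda>\<omega>. f \<omega> - (\<Sum>j\<in>I. a j * e j \<omega>)) (e i) = 0"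
  using assms
proof (induction I arbitrary: f rule: finite_induct)
  case (insert i I)
  have e: "e j \<in> L2" if "j \<in> insert i I" for j
    using insert.prems that by auto
  have comb: "(\<lambda>\<omega>. \<Sum>j\<in>I. a j * e j \<omega>) \<in> L2" for a
    using e by (intro L2_sum L2_cmult) auto
  obtain a where a: "\<forall>j\<in>I. l2_inner (\<lambda>\<omega>. f \<omega> - (\<Sum>j\<in>I. a j * e j \<omega>)) (e j) = 0"
    using insert.IH[of f] insert.prems by auto
  obtain b where b: "\<forall>j\<in>I. l2_inner (\<lambda>\<omega>. e i \<omega> - (\<Sum>j\<in>I. b j * e j \<omega>)) (e j) = 0"
    using insert.IH[of "e i"] insert.prems by auto
  define g where "g = (\<lambda>\<omega>. f \<omega> - (\<Sum>j\<in>I. a j * e j \<omega>))"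
  define r where "r = (\<lambda>\<omega>. e i \<omega> - (\<Sum>j\<in>I. b j * e j \<omega>))"
  \<comment> \<open>If \<open>l2_norm r = 0\<close>, the division yields \<open>c = 0\<close>, which
    is still right: the Cauchy-Schwarz inequality then gives
    \<open>l2_inner g r = 0\<close>.\<close>
  define c where "c = l2_inner g (e i) / of_real ((l2_norm r)\<^sup>2)"
  have gr: "g \<in> L2" "r \<in> L2"
    using comb e insert.prems by (auto simp: g_def r_def intro!: L2_diff)
  have orth: "l2_inner h (e i) = l2_inner h r" if "h \<in> L2" "\<forall>j\<in>I. l2_inner h (e j) = 0" for h
  proof -
    have "l2_inner h r = l2_inner h (e i) - (\<Sum>j\<in>I. cnj (b j) * l2_inner h (e j))"
      unfolding r_def using that(1) e comb
      by (simp add: l2_inner_diff_right l2_inner_sum_right l2_inner_cmult_right L2_cmult)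
    then show ?thesis
      using that(2) by simp
  qed
  have c: "l2_inner g (e i) = c * l2_inner r (e i)"
  proof -
    have "l2_inner g (e i) = l2_inner g r" "l2_inner r (e i) = of_real ((l2_norm r)\<^sup>2)"
      using orth[OF gr(1)] orth[OF gr(2)] a b by (simp_all add: g_def r_def l2_inner_self)
    moreover have "l2_inner g r = 0" if "l2_norm r = 0"
      using l2_Cauchy_Schwarz[OF gr] that by simp
    ultimately show ?thesis
      by (cases "l2_norm r = 0") (simp_all add: c_def)
  qed
  define d where "d j = (if j = i then c else a j - c * b j)" for j
  have "f \<omega> - (\<Sum>j\<in>insert i I. d j * e j \<omega>) = g \<omega> - c * r \<omega>" for \<omega>
  proof -
    have "(\<Sum>j\<in>I. d j * e j \<omega>) = (\<Sum>j\<in>I. a j * e j \<omega> - c * (b j * e j \<omega>))"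
      using insert.hyps by (intro sum.cong) (auto simp: d_def algebra_simps)
    then show ?thesis
      using insert.hyps by (simp add: d_def g_def r_def sum_subtractf sum_distrib_left algebra_simps)
  qed
  then have "l2_inner (\<lambda>\<omega>. f \<omega> - (\<Sum>j\<in>insert i I. d j * e j \<omega>)) (e k)
    = l2_inner g (e k) - c * l2_inner r (e k)" if "k \<in> insert i I" for k
    using gr e[OF that] by (simp add: l2_inner_diff_left L2_cmult l2_inner_cmult_left)
  then show ?case
    using a b c by (intro exI[of _ d]) (auto simp: g_def r_def)
qed simp

lemma plane_wave_L2: "plane_wave \<kappa> x \<in> L2"
proof -
  have "continuous_on UNIV (plane_wave \<kappa> x)"
    unfolding plane_wave_def by (auto intro!: continuous_intros)
  then have "plane_wave \<kappa> x \<in> borel_measurable sphere_measure"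
    by (intro borel_measurable_sphere_measure borel_measurable_continuous_onI)
  then show ?thesis
    by (simp add: L2_def plane_wave_def)
qed

lemma wave_space_L2: "f \<in> wave_space \<kappa> X \<Longrightarrow> f \<in> L2"
  by (auto simp: wave_space_def intro!: L2_sum L2_cmult plane_wave_L2)

lemma wave_space_diff:
  assumes "f \<in> wave_space \<kappa> X" "g \<in> wave_space \<kappa> X"
  shows "(\<lambda>\<omega>. f \<omega> - g \<omega>) \<in> wave_space \<kappa> X"
proof -
  obtain a b where "f = (\<lambda>\<omega>. \<Sum>x\<in>X. a x * plane_wave \<kappa> x \<omega>)" "g = (\<lambda>\<omega>. \<Sum>x\<in>X. b x * plane_wave \<kappa> x \<omega>)"
    using assms by (auto simp: wave_space_def)
  then have "(\<lambda>\<omega>. f \<omega> - g \<omega>) = (\<lambda>\<omega>. \<Sum>x\<in>X. (a x - b x) * plane_wave \<kappa> x \<omega>)"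
    by (simp add: left_diff_distrib sum_subtractf)
  then show ?thesis
    by (auto simp: wave_space_def)
qed

lemma plane_wave_in_wave_space:
  assumes "finite X" "x \<in> X"
  shows "plane_wave \<kappa> x \<in> wave_space \<kappa> X"
proof -
  have "plane_wave \<kappa> x = (\<lambda>\<omega>. \<Sum>y\<in>X. (if y = x then 1 else 0) * plane_wave \<kappa> y \<omega>)"
    using assms by (simp add: if_distrib[of "\<lambda>c. c * _"] cong: if_cong)
  then show ?thesis
    unfolding wave_space_def by (intro CollectI exI[of _ "\<lambda>y. if y = x then 1 else 0"] conjI TrueI)
qed

text \<open>Existence of orthogonal coefficients makes the choice in \<open>orth_proj\<close>
  meaningful. All later facts about it rest on these two properties.\<close>

lemma orth_proj_wave_space:
  assumes "finite X" "f \<in> L2"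
  shows "orth_proj (wave_space \<kappa> X) f \<in> wave_space \<kappa> X"
    and "h \<in> wave_space \<kappa> X \<Longrightarrow> l2_inner (\<lambda>\<omega>. f \<omega> - orth_proj (wave_space \<kappa> X) f \<omega>) h = 0"
proof -
  obtain a where a: "\<forall>x\<in>X. l2_inner (\<lambda>\<omega>. f \<omega> - (\<Sum>y\<in>X. a y * plane_wave \<kappa> y \<omega>)) (plane_wave \<kappa> x) = 0"
    using orthogonal_coefficients_exist[where e = "plane_wave \<kappa>", OF assms(1) plane_wave_L2 assms(2)] by auto
  define g where "g = (\<lambda>\<omega>. \<Sum>y\<in>X. a y * plane_wave \<kappa> y \<omega>)"
  have g: "g \<in> wave_space \<kappa> X"
    by (auto simp: g_def wave_space_def)
  then have fg: "(\<lambda>\<omega>. f \<omega> - g \<omega>) \<in> L2"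
    by (intro L2_diff assms wave_space_L2)
  have "l2_inner (\<lambda>\<omega>. f \<omega> - g \<omega>) h = 0" if h: "h \<in> wave_space \<kappa> X" for h
  proof -
    obtain b where "h = (\<lambda>\<omega>. \<Sum>y\<in>X. b y * plane_wave \<kappa> y \<omega>)"
      using h by (auto simp: wave_space_def)
    then show ?thesis
      using a fg by (simp add: l2_inner_sum_right L2_cmult plane_wave_L2 l2_inner_cmult_right g_def)
  qed
  then have "\<exists>g. g \<in> wave_space \<kappa> X \<and> (\<forall>h\<in>wave_space \<kappa> X. l2_inner (\<lambda>\<omega>. f \<omega> - g \<omega>) h = 0)"
    using g by blast
  then have *: "orth_proj (wave_space \<kappa> X) f \<in> wave_space \<kappa> X \<and>
      (\<forall>h\<in>wave_space \<kappa> X. l2_inner (\<lambda>\<omega>. f \<omega> - orth_proj (wave_space \<kappa> X) f \<omega>) h = 0)"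
    unfolding orth_proj_def by (rule someI_ex)
  from * show "orth_proj (wave_space \<kappa> X) f \<in> wave_space \<kappa> X"
    by blast
  from * show "l2_inner (\<lambda>\<omega>. f \<omega> - orth_proj (wave_space \<kappa> X) f \<omega>) h = 0" if "h \<in> wave_space \<kappa> X"
    using that by blast
qed

lemma orth_proj_L2: "finite X \<Longrightarrow> f \<in> L2 \<Longrightarrow> orth_proj (wave_space \<kappa> X) f \<in> L2"
  using orth_proj_wave_space(1) wave_space_L2 by blast

lemma orth_proj_Pythagoras:
  assumes "finite X" "f \<in> L2" "v \<in> wave_space \<kappa> X"
  shows "(l2_norm (\<lambda>\<omega>. f \<omega> - v \<omega>))\<^sup>2 = (l2_norm (\<lambda>\<omega>. f \<omega> - orth_proj (wave_space \<kappa> X) f \<omega>))\<^sup>2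
      + (l2_norm (\<lambda>\<omega>. orth_proj (wave_space \<kappa> X) f \<omega> - v \<omega>))\<^sup>2"
proof -
  let ?p = "orth_proj (wave_space \<kappa> X) f"
  have p: "?p \<in> wave_space \<kappa> X"
    using assms(1,2) by (rule orth_proj_wave_space)
  have "(l2_norm (\<lambda>\<omega>. (f \<omega> - ?p \<omega>) + (?p \<omega> - v \<omega>)))\<^sup>2
    = (l2_norm (\<lambda>\<omega>. f \<omega> - ?p \<omega>))\<^sup>2 + (l2_norm (\<lambda>\<omega>. ?p \<omega> - v \<omega>))\<^sup>2"
    using orth_proj_wave_space(2)[OF assms(1,2) wave_space_diff[OF p assms(3)]] p assms
    by (subst l2_norm_add_power2) (simp_all add: L2_diff wave_space_L2)
  then show ?thesis
    by simp
qed

lemma orth_proj_minimal: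
  assumes "finite X" "f \<in> L2" "v \<in> wave_space \<kappa> X"
  shows "l2_norm (\<lambda>\<omega>. f \<omega> - orth_proj (wave_space \<kappa> X) f \<omega>) \<le> l2_norm (\<lambda>\<omega>. f \<omega> - v \<omega>)"
  by (rule power2_le_imp_le) (simp_all add: orth_proj_Pythagoras[OF assms] l2_norm_nonneg)

lemma zero_wave_space: "(\<lambda>\<omega>. 0) \<in> wave_space \<kappa> X"
  unfolding wave_space_def by (auto intro!: exI[of _ "\<lambda>_. 0"])

lemma orth_proj_norm:
  assumes "finite X" "f \<in> L2"
  shows "(l2_norm f)\<^sup>2 = (l2_norm (\<lambda>\<omega>. f \<omega> - orth_proj (wave_space \<kappa> X) f \<omega>))\<^sup>2
      + (l2_norm (orth_proj (wave_space \<kappa> X) f))\<^sup>2"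
  using orth_proj_Pythagoras[OF assms zero_wave_space] by simp

section \<open>The Gram matrix of plane waves\<close>

text \<open>One wave times the conjugate of another is the wave of the difference of the two points,
  whose mean is known.\<close>

lemma l2_inner_plane_wave:
  assumes "0 < \<kappa>"
  shows "l2_inner (plane_wave \<kappa> x) (plane_wave \<kappa> y) = of_real (sinc (\<kappa> * norm (x - y)))"
proof -
  have "plane_wave \<kappa> x \<omega> * cnj (plane_wave \<kappa> y \<omega>) = plane_wave \<kappa> (x - y) \<omega>" for \<omega>
    by (simp add: plane_wave_def exp_cnj exp_add[symmetric] inner_diff_right algebra_simps)
  then show ?thesis
    using assms by (simp add: l2_inner_def integral_plane_wave)
qed

lemma l2_norm_plane_wave: "0 < \<kappa> \<Longrightarrow> l2_norm (plane_wave \<kappa> x) = 1"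
  using l2_norm_power2_Re[of "plane_wave \<kappa> x"] l2_norm_nonneg[of "plane_wave \<kappa> x"]
  by (simp add: l2_inner_plane_wave sinc_def power2_eq_1_iff)

lemma l2_norm_plane_wave_diff:
  assumes "0 < \<kappa>"
  shows "(l2_norm (\<lambda>\<omega>. plane_wave \<kappa> x \<omega> - plane_wave \<kappa> y \<omega>))\<^sup>2 = 2 * (1 - sinc (\<kappa> * norm (x - y)))"
  using assms by (simp add: l2_norm_diff_power2 plane_wave_L2 l2_norm_plane_wave l2_inner_plane_wave)

lemma l2_norm_plane_wave_diff_le:
  assumes "0 < \<kappa>"
  shows "l2_norm (\<lambda>\<omega>. plane_wave \<kappa> x \<omega> - plane_wave \<kappa> y \<omega>) \<le> \<kappa> * norm (x - y) / sqrt 3"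
proof (rule power2_le_imp_le)
  show "(l2_norm (\<lambda>\<omega>. plane_wave \<kappa> x \<omega> - plane_wave \<kappa> y \<omega>))\<^sup>2 \<le> (\<kappa> * norm (x - y) / sqrt 3)\<^sup>2"
    using assms sinc_ge[of "\<kappa> * norm (x - y)"] by (simp add: l2_norm_plane_wave_diff power_divide)
qed (use assms in simp)

text \<open>Gershgorin's estimate for the least eigenvalue of the Gram matrix.\<close>

lemma Gram_lower_bound:
  assumes X: "finite X" "0 < \<kappa>"
    and row: "\<And>x. x \<in> X \<Longrightarrow> (\<Sum>y\<in>X - {x}. \<bar>sinc (\<kappa> * norm (x - y))\<bar>) \<le> \<mu>"
  shows "(1 - \<mu>) * (\<Sum>x\<in>X. (cmod (a x))\<^sup>2) \<le> (l2_norm (\<lambda>\<omega>. \<Sum>x\<in>X. a x * plane_wave \<kappa> x \<omega>))\<^sup>2"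
proof -
  define G where "G x y = sinc (\<kappa> * norm (x - y))" for x y :: "real^3"
  define S where "S x y = (if x = y then 0 else \<bar>G x y\<bar>)" for x y
  have sym: "S x y = S y x" for x y
    by (simp add: S_def G_def norm_minus_commute)
  have nonneg: "0 \<le> S x y" for x y
    by (simp add: S_def)
  have row': "(\<Sum>y\<in>X. S x y) \<le> \<mu>" if "x \<in> X" for x
  proof -
    have "(\<Sum>y\<in>X. S x y) = (\<Sum>y\<in>X - {x}. S x y)"
      using sum.remove[OF X(1) that, of "S x"] by (simp add: S_def)
    also have "\<dots> = (\<Sum>y\<in>X - {x}. \<bar>sinc (\<kappa> * norm (x - y))\<bar>)"
      by (intro sum.cong) (auto simp: S_def G_def)
    finally show ?thesis
      using row[OF that] by simp
  qed
  \<comment> \<open>Off the diagonal, the product of two coefficients is bounded by the mean of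
    their squares; after summation, the symmetry of \<open>S\<close> turns these terms into row
    sums.\<close>
  have entry: "(if x = y then (cmod (a x))\<^sup>2 else 0) - ((cmod (a x))\<^sup>2 + (cmod (a y))\<^sup>2) / 2 * S x y
      \<le> Re (a x * cnj (a y) * G x y)" for x y
  proof (cases "x = y")
    case True
    moreover have "Re (a x * cnj (a x)) = (cmod (a x))\<^sup>2"
      by (simp only: Re_complex_of_real flip: complex_norm_square)
    ultimately show ?thesis
      by (simp add: S_def G_def sinc_def)
  next
    case False
    have "cmod (a x) * cmod (a y) \<le> ((cmod (a x))\<^sup>2 + (cmod (a y))\<^sup>2) / 2"
      using sum_squares_bound[of "cmod (a x)" "cmod (a y)"] by simp
    then have "cmod (a x * cnj (a y) * G x y) \<le> ((cmod (a x))\<^sup>2 + (cmod (a y))\<^sup>2) / 2 * S x y"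
      using False mult_right_mono[of _ _ "\<bar>G x y\<bar>"] by (simp add: norm_mult S_def del: times_divide_eq_left)
    then show ?thesis
      using False abs_Re_le_cmod[of "a x * cnj (a y) * G x y"] by simp
  qed
  have "(\<Sum>x\<in>X. \<Sum>y\<in>X. ((cmod (a x))\<^sup>2 + (cmod (a y))\<^sup>2) / 2 * S x y)
      = (\<Sum>x\<in>X. \<Sum>y\<in>X. (cmod (a x))\<^sup>2 / 2 * S x y) + (\<Sum>x\<in>X. \<Sum>y\<in>X. (cmod (a y))\<^sup>2 / 2 * S x y)"
    by (simp add: add_divide_distrib distrib_right sum.distrib)
  also have "(\<Sum>x\<in>X. \<Sum>y\<in>X. (cmod (a y))\<^sup>2 / 2 * S x y) = (\<Sum>x\<in>X. \<Sum>y\<in>X. (cmod (a x))\<^sup>2 / 2 * S x y)"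
    by (subst sum.swap) (simp add: sym)
  also have "(\<Sum>x\<in>X. \<Sum>y\<in>X. (cmod (a x))\<^sup>2 / 2 * S x y) + (\<Sum>x\<in>X. \<Sum>y\<in>X. (cmod (a x))\<^sup>2 / 2 * S x y)
      = (\<Sum>x\<in>X. (cmod (a x))\<^sup>2 * (\<Sum>y\<in>X. S x y))"
    unfolding sum.distrib[symmetric] sum_distrib_left by (intro sum.cong refl) simp
  also have "\<dots> \<le> (\<Sum>x\<in>X. (cmod (a x))\<^sup>2 * \<mu>)"
    by (intro sum_mono mult_left_mono row') simp_all
  finally have off: "(\<Sum>x\<in>X. \<Sum>y\<in>X. ((cmod (a x))\<^sup>2 + (cmod (a y))\<^sup>2) / 2 * S x y) \<le> \<mu> * (\<Sum>x\<in>X. (cmod (a x))\<^sup>2)"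
    by (simp add: sum_distrib_left mult.commute)
  have "(1 - \<mu>) * (\<Sum>x\<in>X. (cmod (a x))\<^sup>2)
    \<le> (\<Sum>x\<in>X. (cmod (a x))\<^sup>2) - (\<Sum>x\<in>X. \<Sum>y\<in>X. ((cmod (a x))\<^sup>2 + (cmod (a y))\<^sup>2) / 2 * S x y)"
    using off by (simp add: left_diff_distrib)
  also have "\<dots> = (\<Sum>x\<in>X. \<Sum>y\<in>X. (if x = y then (cmod (a x))\<^sup>2 else 0) - ((cmod (a x))\<^sup>2 + (cmod (a y))\<^sup>2) / 2 * S x y)"
    using X(1) by (simp add: sum_subtractf)
  also have "\<dots> \<le> (\<Sum>x\<in>X. \<Sum>y\<in>X. Re (a x * cnj (a y) * G x y))"
    by (intro sum_mono entry)
  also have "\<dots> = (l2_norm (\<lambda>\<omega>. \<Sum>x\<in>X. a x * plane_wave \<kappa> x \<omega>))\<^sup>2"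
    unfolding l2_norm_power2_Re G_def
    by (simp add: l2_inner_sum_left l2_inner_sum_right L2_sum L2_cmult plane_wave_L2 l2_inner_cmult_left
        l2_inner_cmult_right l2_inner_plane_wave X(2) sum_distrib_left mult.assoc del: Re_sum) (simp add: algebra_simps)
  finally show ?thesis .
qed

text \<open>If the projection is the sum of \<open>a x\<close> times the waves, its squared norm is
  its inner product with \<open>f\<close>, a sum of products of the \<open>a x\<close> with the data
  \<open>k x\<close>. Young's inequality with weight \<open>1 - \<mu>\<close> splits them, and the
  Gram bound absorbs the part with the \<open>a x\<close>.\<close>

lemma orth_proj_norm_le:
  assumes X: "finite X" "0 < \<kappa>" "\<mu> < 1" "f \<in> L2"
    and row: "\<And>x. x \<in> X \<Longrightarrow> (\<Sum>y\<in>X - {x}. \<bar>sinc (\<kappa> * norm (x - y))\<bar>) \<le> \<mu>"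
  shows "(l2_norm (orth_proj (wave_space \<kappa> X) f))\<^sup>2 \<le> (\<Sum>x\<in>X. (cmod (l2_inner f (plane_wave \<kappa> x)))\<^sup>2) / (1 - \<mu>)"
proof -
  let ?p = "orth_proj (wave_space \<kappa> X) f"
  define k where "k x = l2_inner f (plane_wave \<kappa> x)" for x
  have p: "?p \<in> wave_space \<kappa> X" "?p \<in> L2"
    using X orth_proj_wave_space(1) orth_proj_L2 by auto
  obtain a where a: "?p = (\<lambda>\<omega>. \<Sum>x\<in>X. a x * plane_wave \<kappa> x \<omega>)"
    using p by (auto simp: wave_space_def)
  have "l2_inner (\<lambda>\<omega>. f \<omega> - ?p \<omega>) ?p = 0"
    using orth_proj_wave_space(2)[OF X(1,4) p(1)] .
  then have "l2_inner ?p ?p = l2_inner f ?p"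
    using p X by (simp add: l2_inner_diff_left)
  also have "\<dots> = (\<Sum>x\<in>X. cnj (a x) * k x)"
    unfolding a using X by (simp add: l2_inner_sum_right L2_cmult plane_wave_L2 l2_inner_cmult_right k_def)
  finally have "(l2_norm ?p)\<^sup>2 = Re (\<Sum>x\<in>X. cnj (a x) * k x)"
    by (simp only: l2_norm_power2_Re)
  also have "\<dots> \<le> (\<Sum>x\<in>X. cmod (cnj (a x) * k x))"
    using complex_Re_le_cmod norm_sum order_trans by blast
  also have "\<dots> \<le> (\<Sum>x\<in>X. ((1 - \<mu>) * (cmod (a x))\<^sup>2 + (cmod (k x))\<^sup>2 / (1 - \<mu>)) / 2)"
  proof (rule sum_mono)
    fix x
    have "2 * (sqrt (1 - \<mu>) * cmod (a x)) * (cmod (k x) / sqrt (1 - \<mu>))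
      \<le> (sqrt (1 - \<mu>) * cmod (a x))\<^sup>2 + (cmod (k x) / sqrt (1 - \<mu>))\<^sup>2"
      by (rule sum_squares_bound)
    then show "cmod (cnj (a x) * k x) \<le> ((1 - \<mu>) * (cmod (a x))\<^sup>2 + (cmod (k x))\<^sup>2 / (1 - \<mu>)) / 2"
      using X(3) by (simp add: norm_mult power_mult_distrib power_divide)
  qed
  also have "\<dots> = ((1 - \<mu>) * (\<Sum>x\<in>X. (cmod (a x))\<^sup>2) + (\<Sum>x\<in>X. (cmod (k x))\<^sup>2) / (1 - \<mu>)) / 2"
    by (simp add: sum.distrib sum_distrib_left flip: sum_divide_distrib)
  finally have "(l2_norm ?p)\<^sup>2 \<le> ((1 - \<mu>) * (\<Sum>x\<in>X. (cmod (a x))\<^sup>2) + (\<Sum>x\<in>X. (cmod (k x))\<^sup>2) / (1 - \<mu>)) / 2" .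
  moreover have "(1 - \<mu>) * (\<Sum>x\<in>X. (cmod (a x))\<^sup>2) \<le> (l2_norm ?p)\<^sup>2"
    unfolding a by (rule Gram_lower_bound[OF X(1,2) row])
  moreover have "P \<le> B" if "P \<le> (A + B) / 2" "A \<le> P" for A B P :: real
    using that by (simp add: field_simps)
  ultimately show ?thesis
    unfolding k_def by blast
qed

section \<open>Residuals of plane waves\<close>

text \<open>Chain rule: by the Cauchy-Schwarz inequality the norm changes along the line at speed at
  most \<open>norm v\<close>, and the derivative of sinc is at most \<open>c_nu\<close> over its
  argument.\<close>

lemma DERIV_sinc_norm_line:
  fixes u v :: "'a::real_inner"
  assumes "0 < \<kappa>" "u + \<tau> *\<^sub>R v \<noteq> 0"
  obtains D where "((\<lambda>\<tau>. sinc (\<kappa> * norm (u + \<tau> *\<^sub>R v))) has_real_derivative D) (at \<tau>)"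
    and "\<bar>D\<bar> \<le> \<kappa> * norm v * (c_nu / (\<kappa> * norm (u + \<tau> *\<^sub>R v)))"
proof -
  \<comment> \<open>The norm is the square root of this quadratic polynomial, which is
    differentiable where it is positive.\<close>
  define Q where "Q \<tau> = u \<bullet> u + 2 * \<tau> * (u \<bullet> v) + \<tau>\<^sup>2 * (v \<bullet> v)" for \<tau>
  define n where "n = norm (u + \<tau> *\<^sub>R v)"
  define t where "t = \<kappa> * n"
  have norm: "norm (u + \<tau> *\<^sub>R v) = sqrt (Q \<tau>)" for \<tau>
    by (simp add: norm_eq_sqrt_inner Q_def inner_add_left inner_add_right inner_commute power2_eq_square algebra_simps)
  have n: "0 < n" "sqrt (Q \<tau>) = n"
    using assms(2) unfolding n_def norm[symmetric] by simp_all
  then have Q: "0 < Q \<tau>"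
    using real_sqrt_gt_0_iff by metis
  have "((\<lambda>\<tau>. sqrt (Q \<tau>)) has_real_derivative (2 * (u \<bullet> v) + 2 * \<tau> * (v \<bullet> v)) * (inverse (sqrt (Q \<tau>)) / 2)) (at \<tau>)"
    using Q unfolding Q_def by (auto intro!: derivative_eq_intros)
  moreover have "(2 * (u \<bullet> v) + 2 * \<tau> * (v \<bullet> v)) * (inverse (sqrt (Q \<tau>)) / 2) = ((u + \<tau> *\<^sub>R v) \<bullet> v) / n"
    using n by (simp add: inner_add_left field_simps)
  ultimately have dn: "((\<lambda>\<tau>. \<kappa> * norm (u + \<tau> *\<^sub>R v)) has_real_derivative \<kappa> * (((u + \<tau> *\<^sub>R v) \<bullet> v) / n)) (at \<tau>)"
    unfolding norm by (intro DERIV_cmult) simp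
  have t: "0 < t" "\<kappa> * norm (u + \<tau> *\<^sub>R v) = t"
    using n assms(1) by (simp_all add: t_def n_def)
  define D where "D = ((t * cos t - sin t) / t\<^sup>2) * (\<kappa> * (((u + \<tau> *\<^sub>R v) \<bullet> v) / n))"
  have "((\<lambda>\<tau>. sinc (\<kappa> * norm (u + \<tau> *\<^sub>R v))) has_real_derivative D) (at \<tau>)"
    unfolding D_def using t(1) by (intro DERIV_chain2[OF _ dn]) (simp add: t(2) DERIV_sinc)
  moreover have "\<bar>D\<bar> \<le> (c_nu / t) * (\<kappa> * norm v)"
  proof -
    have le: "\<bar>((u + \<tau> *\<^sub>R v) \<bullet> v) / n\<bar> \<le> norm v"
      using Cauchy_Schwarz_ineq2[of "u + \<tau> *\<^sub>R v" v] n(1) by (simp add: n_def[symmetric] abs_div_pos[symmetric] pos_divide_le_eq mult.commute del: abs_divide)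
    have "\<bar>\<kappa> * (((u + \<tau> *\<^sub>R v) \<bullet> v) / n)\<bar> \<le> \<kappa> * norm v"
      using mult_left_mono[OF le less_imp_le[OF assms(1)]] assms(1) by (simp only: abs_mult abs_of_pos)
    then show ?thesis
      unfolding D_def abs_mult[of "_ / t\<^sup>2"] using deriv_sinc_le[OF t(1)] one_le_c_nu t(1)
      by (intro mult_mono) simp_all
  qed
  ultimately show ?thesis
    using that t(2) by (simp add: mult.commute)
qed

section \<open>Estimates for a single configuration\<close>

locale config =
  fixes s :: nat and \<kappa> \<gamma> \<mu> :: real and X :: "(real^3) set"
  assumes s: "2 \<le> s" and pos: "0 < \<kappa>" "0 < \<gamma>" "0 \<le> \<mu>" "\<mu> < 1"
    and X: "X \<in> uniform_class s \<kappa> \<gamma> \<mu>"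
begin

lemma finite_X: "finite X" and card_X: "card X = s"
  using X by (simp_all add: uniform_class_def configs_def)

text \<open>The minimum in \<open>min_sep\<close> ranges over a finite set, which is nonempty
  because \<open>2 \<le> s\<close> provides two distinct points.\<close>

lemma separation:
  shows "0 < min_sep X"
    and "\<And>x y. x \<in> X \<Longrightarrow> y \<in> X \<Longrightarrow> x \<noteq> y \<Longrightarrow> min_sep X \<le> norm (x - y)"
proof -
  define D where "D = {norm (x - y) | x y. x \<in> X \<and> y \<in> X \<and> x \<noteq> y}"
  have "D \<subseteq> (\<lambda>(x, y). norm (x - y)) ` (X \<times> X)"
    by (auto simp: D_def)
  then have fin: "finite D"
    using finite_X finite_subset by blast
  obtain x y where "x \<in> X" "y \<in> X" "x \<noteq> y"
    using s card_X card_le_Suc0_iff_eq[OF finite_X] by force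
  then have "D \<noteq> {}"
    by (auto simp: D_def)
  then show "0 < min_sep X"
    using fin by (subst min_sep_def, fold D_def, subst Min_gr_iff) (auto simp: D_def)
  show "min_sep X \<le> norm (x - y)" if "x \<in> X" "y \<in> X" "x \<noteq> y" for x y
    using that fin by (subst min_sep_def, fold D_def, intro Min_le) (auto simp: D_def)
qed

lemma radius_le: "\<gamma> / \<kappa> \<le> min_sep X / 2" and mu_of_le: "mu_of \<kappa> X \<le> \<mu>"
  using X by (simp_all add: uniform_class_def)

lemma mu_of_eq: "mu_of \<kappa> X = 9 / 2 * (root 3 s)\<^sup>2 / (\<kappa> * min_sep X)"
proof -
  have "(root 3 s)\<^sup>2 = real s powr (2 / 3)"
    using s by (simp add: root_powr_inverse powr_power)
  then show ?thesis
    by (simp add: mu_of_def card_X)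
qed

text \<open>The decay of sinc reduces the row sum to the packing sum of inverse distances.\<close>

lemma Gershgorin:
  assumes "x \<in> X"
  shows "(\<Sum>y\<in>X - {x}. \<bar>sinc (\<kappa> * norm (x - y))\<bar>) \<le> \<mu>"
proof -
  let ?d = "min_sep X"
  have far: "?d \<le> norm (x - y)" if "y \<in> X - {x}" for y
    using separation(2)[OF assms, of y] that by auto
  have "(\<Sum>y\<in>X - {x}. \<bar>sinc (\<kappa> * norm (x - y))\<bar>) \<le> (\<Sum>y\<in>X - {x}. 1 / \<kappa> * (1 / norm (x - y)))"
  proof (rule sum_mono)
    fix y assume "y \<in> X - {x}"
    then have "0 < \<kappa> * norm (x - y)"
      using pos by auto
    then show "\<bar>sinc (\<kappa> * norm (x - y))\<bar> \<le> 1 / \<kappa> * (1 / norm (x - y))"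
      using sinc_le_inverse by fastforce
  qed
  also have "\<dots> = 1 / \<kappa> * (\<Sum>y\<in>X - {x}. 1 / norm (x - y))"
    by (rule sum_distrib_left[symmetric])
  \<comment> \<open>The centre is itself a point of \<open>X\<close>, so all other points are at
    least \<open>?d\<close> away and \<open>K = 3 / 2\<close> is admissible;
    \<open>2 * (3 / 2) * (3 / 2)\<close> is the factor \<open>9 / 2\<close> of
    \<open>mu_of\<close>.\<close>
  also have "\<dots> \<le> 1 / \<kappa> * (2 * (3 / 2) / ?d * (3 / 2 * (root 3 (card X))\<^sup>2))"
  proof (intro mult_left_mono packing_sums(1)[OF finite_X separation(1) assms separation(2)])
    fix y assume "y \<in> X - {x}"
    then show "norm (x - y) + ?d / 2 \<le> 3 / 2 * norm (x - y)"
      using far[of y] by linarith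
  qed (use pos in simp_all)
  also have "\<dots> = mu_of \<kappa> X"
    by (simp add: mu_of_eq card_X)
  finally show ?thesis
    using mu_of_le by linarith
qed

text \<open>If \<open>x0\<close> is a point of \<open>X\<close> nearest to \<open>z\<close>, the
  triangle inequality leaves at least half the separation to the others, so the packing sum of
  inverse squares applies with \<open>K = 2\<close>.\<close>

lemma far_points:
  assumes x0: "x0 \<in> X" and near: "\<And>y. y \<in> X - {x0} \<Longrightarrow> norm (z - x0) \<le> norm (z - y)"
  shows "\<And>y. y \<in> X - {x0} \<Longrightarrow> min_sep X / 2 \<le> norm (z - y)"
    and "(\<Sum>y\<in>X - {x0}. (c_nu / (\<kappa> * norm (z - y)))\<^sup>2) \<le> nu_bar s \<mu>"
proof -
  let ?d = "min_sep X"
  show far: "?d / 2 \<le> norm (z - y)" if "y \<in> X - {x0}" for y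
  proof -
    have "?d \<le> norm (x0 - y)"
      using separation(2)[OF x0, of y] that by auto
    also have "\<dots> \<le> norm (z - x0) + norm (z - y)"
      using norm_triangle_ineq4[of "z - y" "z - x0"] by simp
    finally show ?thesis
      using near[OF that] by linarith
  qed
  define r where "r = root 3 (real s)"
  have r: "0 < r" "r ^ 3 = real s"
    using s by (simp_all add: r_def)
  have "(\<Sum>y\<in>X - {x0}. (c_nu / (\<kappa> * norm (z - y)))\<^sup>2) = (c_nu / \<kappa>)\<^sup>2 * (\<Sum>y\<in>X - {x0}. 1 / (norm (z - y))\<^sup>2)"
    by (simp add: sum_distrib_left power_divide power_mult_distrib)
  also have "\<dots> \<le> (c_nu / \<kappa>)\<^sup>2 * ((2 * 2 / ?d)\<^sup>2 * (3 * root 3 (card X)))"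
  proof (intro mult_left_mono packing_sums(2)[OF finite_X separation(1) x0 separation(2) near])
    fix y assume "y \<in> X - {x0}"
    then show "norm (z - y) + ?d / 2 \<le> 2 * norm (z - y)"
      using far[of y] by linarith
  qed simp_all
  \<comment> \<open>Both sides equal 48 times
    \<open>c_nu\<^sup>2 * root 3 s / (\<kappa> * min_sep X)\<^sup>2\<close>; on the right, 48 is
    \<open>64 / 27\<close> times the square of \<open>9 / 2\<close>.\<close>
  also have "\<dots> = 64 * c_nu\<^sup>2 / 27 * ((mu_of \<kappa> X)\<^sup>2 / real s)"
    unfolding mu_of_eq card_X r_def[symmetric] unfolding r(2)[symmetric]
    using r(1) pos separation(1) by (simp add: field_simps power2_eq_square power3_eq_cube)
  also have "\<dots> \<le> nu_bar s \<mu>"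
  proof -
    have "0 \<le> mu_of \<kappa> X"
      using pos separation(1) by (simp add: mu_of_eq)
    then have "(mu_of \<kappa> X)\<^sup>2 \<le> \<mu>\<^sup>2"
      using mu_of_le by (intro power_mono)
    then show ?thesis
      unfolding nu_bar_def by (intro mult_left_mono divide_right_mono) simp_all
  qed
  finally show "(\<Sum>y\<in>X - {x0}. (c_nu / (\<kappa> * norm (z - y)))\<^sup>2) \<le> nu_bar s \<mu>" .
qed

lemma projection_norm_le:
  "f \<in> L2 \<Longrightarrow> (l2_norm (orth_proj (wave_space \<kappa> X) f))\<^sup>2
    \<le> (\<Sum>x\<in>X. (cmod (l2_inner f (plane_wave \<kappa> x)))\<^sup>2) / (1 - \<mu>)"
  by (rule orth_proj_norm_le[OF finite_X pos(1,4) _ Gershgorin])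

text \<open>The nearest point contributes at most \<open>1 - b_const \<gamma>\<close> to the squared
  inner products, all other points together at most \<open>nu_bar s \<mu>\<close>. Division by
  \<open>1 - \<mu>\<close> bounds the projection, and \<open>A_star\<close> is what remains of the
  unit norm.\<close>

lemma residual_far:
  assumes "\<And>x. x \<in> X \<Longrightarrow> \<gamma> / \<kappa> \<le> norm (z - x)"
  shows "A_star s \<gamma> \<mu> \<le> (l2_norm (\<lambda>\<omega>. plane_wave \<kappa> z \<omega> - orth_proj (wave_space \<kappa> X) (plane_wave \<kappa> z) \<omega>))\<^sup>2"
proof -
  let ?f = "plane_wave \<kappa> z"
  have ne: "X \<noteq> {}"
    using s card_X by auto
  define x0 where "x0 = arg_min_on (\<lambda>x. norm (z - x)) X"
  have x0: "x0 \<in> X" "\<And>y. y \<in> X \<Longrightarrow> norm (z - x0) \<le> norm (z - y)"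
    unfolding x0_def using finite_X ne by (auto intro: arg_min_if_finite(1) arg_min_least)
  have "(\<Sum>x\<in>X. (cmod (l2_inner ?f (plane_wave \<kappa> x)))\<^sup>2) = (\<Sum>x\<in>X. (sinc (\<kappa> * norm (z - x)))\<^sup>2)"
    by (simp add: l2_inner_plane_wave pos(1))
  also have "\<dots> = (sinc (\<kappa> * norm (z - x0)))\<^sup>2 + (\<Sum>x\<in>X - {x0}. (sinc (\<kappa> * norm (z - x)))\<^sup>2)"
    by (rule sum.remove[OF finite_X x0(1)])
  also have "\<dots> \<le> (1 - b_const \<gamma>) + nu_bar s \<mu>"
  proof (rule add_mono)
    have "\<gamma> \<le> \<kappa> * norm (z - x0)"
      using assms[OF x0(1)] pos by (simp add: pos_divide_le_eq mult.commute)
    then show "(sinc (\<kappa> * norm (z - x0)))\<^sup>2 \<le> 1 - b_const \<gamma>"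
      by (rule sinc_squared_le_b_const[OF pos(2)])
    have "(\<Sum>x\<in>X - {x0}. (sinc (\<kappa> * norm (z - x)))\<^sup>2) \<le> (\<Sum>x\<in>X - {x0}. (c_nu / (\<kappa> * norm (z - x)))\<^sup>2)"
    proof (rule sum_mono)
      fix x assume "x \<in> X - {x0}"
      then have "0 < norm (z - x)"
        using assms[of x] divide_pos_pos[OF pos(2,1)] by (simp del: zero_less_norm_iff)
      then have t: "0 < \<kappa> * norm (z - x)"
        using pos by simp
      have "\<bar>sinc (\<kappa> * norm (z - x))\<bar> \<le> c_nu / (\<kappa> * norm (z - x))"
        using sinc_le_inverse[OF t] divide_right_mono[OF one_le_c_nu less_imp_le[OF t]] by linarith
      then show "(sinc (\<kappa> * norm (z - x)))\<^sup>2 \<le> (c_nu / (\<kappa> * norm (z - x)))\<^sup>2"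
        using power_mono[of "\<bar>sinc (\<kappa> * norm (z - x))\<bar>" _ 2] by simp
    qed
    also have "\<dots> \<le> nu_bar s \<mu>"
      using x0 by (intro far_points(2)) auto
    finally show "(\<Sum>x\<in>X - {x0}. (sinc (\<kappa> * norm (z - x)))\<^sup>2) \<le> nu_bar s \<mu>" .
  qed
  finally have "(l2_norm (orth_proj (wave_space \<kappa> X) ?f))\<^sup>2 \<le> ((1 - b_const \<gamma>) + nu_bar s \<mu>) / (1 - \<mu>)"
    using projection_norm_le[OF plane_wave_L2] pos(4) by (meson diff_ge_0_iff_ge divide_right_mono less_imp_le order_trans)
  moreover have "1 - ((1 - b_const \<gamma>) + nu_bar s \<mu>) / (1 - \<mu>) = A_star s \<gamma> \<mu>"
    using pos(4) by (simp add: A_star_def field_simps)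
  ultimately show ?thesis
    using orth_proj_norm[OF finite_X plane_wave_L2[of \<kappa> z], of \<kappa>] by (simp add: l2_norm_plane_wave pos(1))
qed

text \<open>A mean value estimate for a vector of functions. The vector is paired with its own total
  increment \<open>a\<close>, so the scalar mean value theorem yields one parameter \<tau> at which
  the sum of the squared derivatives dominates the sum of the squared increments.\<close>

lemma sinc_increments:
  assumes x: "x \<in> X" and y: "norm (y - x) \<le> \<gamma> / \<kappa>"
  shows "(\<Sum>j\<in>X - {x}. (sinc (\<kappa> * norm (y - j)) - sinc (\<kappa> * norm (x - j)))\<^sup>2) \<le> (\<kappa> * norm (y - x))\<^sup>2 * nu_bar s \<mu>"
proof -
  define S where "S j \<tau> = sinc (\<kappa> * norm ((x - j) + \<tau> *\<^sub>R (y - x)))" for j \<tau>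
  define a where "a j = S j 1 - S j 0" for j
  have line: "(x - j) + \<tau> *\<^sub>R (y - x) = (x + \<tau> *\<^sub>R (y - x)) - j" for j \<tau>
    by simp
  \<comment> \<open>The segment stays within half the separation of \<open>x\<close>, so
    \<open>x\<close> remains a nearest point of \<open>X\<close> along all of it.\<close>
  have near: "norm ((x + \<tau> *\<^sub>R (y - x)) - x) \<le> norm ((x + \<tau> *\<^sub>R (y - x)) - j)"
    if "0 \<le> \<tau>" "\<tau> \<le> 1" "j \<in> X - {x}" for \<tau> j
  proof -
    let ?z = "x + \<tau> *\<^sub>R (y - x)"
    have "norm (?z - x) \<le> norm (y - x)"
      using that by (simp add: mult_left_le_one_le)
    also have "\<dots> \<le> min_sep X / 2"
      using y radius_le by linarith
    finally have "norm (?z - x) \<le> min_sep X / 2" .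
    moreover have "min_sep X \<le> norm (x - j)"
      using separation(2)[OF x, of j] that by auto
    moreover have "norm (x - j) \<le> norm (?z - x) + norm (?z - j)"
      using norm_triangle_ineq4[of "?z - j" "?z - x"] by simp
    ultimately show ?thesis
      by linarith
  qed
  have "\<exists>D. (S j has_real_derivative D) (at \<tau>) \<and>
      \<bar>D\<bar> \<le> \<kappa> * norm (y - x) * (c_nu / (\<kappa> * norm ((x + \<tau> *\<^sub>R (y - x)) - j)))"
    if "0 \<le> \<tau>" "\<tau> \<le> 1" "j \<in> X - {x}" for \<tau> j
  proof -
    have "0 < norm ((x + \<tau> *\<^sub>R (y - x)) - j)"
      using far_points(1)[OF x near, of \<tau> j] that separation(1) by (simp del: zero_less_norm_iff)
    then have "(x - j) + \<tau> *\<^sub>R (y - x) \<noteq> 0"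
      unfolding line by simp
    from DERIV_sinc_norm_line[OF pos(1) this] show ?thesis
      unfolding S_def line by metis
  qed
  then obtain D where D: "\<And>\<tau> j. 0 \<le> \<tau> \<Longrightarrow> \<tau> \<le> 1 \<Longrightarrow> j \<in> X - {x} \<Longrightarrow> (S j has_real_derivative D \<tau> j) (at \<tau>)"
    "\<And>\<tau> j. 0 \<le> \<tau> \<Longrightarrow> \<tau> \<le> 1 \<Longrightarrow> j \<in> X - {x} \<Longrightarrow>
      \<bar>D \<tau> j\<bar> \<le> \<kappa> * norm (y - x) * (c_nu / (\<kappa> * norm ((x + \<tau> *\<^sub>R (y - x)) - j)))"
    by metis
  \<comment> \<open>The increment of \<open>H\<close> from \<open>0\<close> to \<open>1\<close> is
    the sum of the squares of the \<open>a j\<close>.\<close>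
  define H where "H \<tau> = (\<Sum>j\<in>X - {x}. a j * S j \<tau>)" for \<tau>
  have "(H has_real_derivative (\<Sum>j\<in>X - {x}. a j * D \<tau> j)) (at \<tau>)" if "0 \<le> \<tau>" "\<tau> \<le> 1" for \<tau>
    unfolding H_def using D(1)[OF that] by (intro DERIV_sum DERIV_cmult)
  then obtain \<tau> where \<tau>: "0 < \<tau>" "\<tau> < 1" "H 1 - H 0 = (1 - 0) * (\<Sum>j\<in>X - {x}. a j * D \<tau> j)"
    using MVT2[of 0 1 H "\<lambda>\<tau>. \<Sum>j\<in>X - {x}. a j * D \<tau> j"] by auto
  have "(\<Sum>j\<in>X - {x}. (a j)\<^sup>2) = H 1 - H 0"
    by (simp add: H_def a_def power2_eq_square right_diff_distrib flip: sum_subtractf)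
  also have "\<dots> = (\<Sum>j\<in>X - {x}. a j * D \<tau> j)"
    using \<tau>(3) by simp
  also have "\<dots> \<le> (\<Sum>j\<in>X - {x}. ((a j)\<^sup>2 + (D \<tau> j)\<^sup>2) / 2)"
  proof (rule sum_mono)
    fix j
    show "a j * D \<tau> j \<le> ((a j)\<^sup>2 + (D \<tau> j)\<^sup>2) / 2"
      using sum_squares_bound[of "a j" "D \<tau> j"] by simp
  qed
  also have "\<dots> = ((\<Sum>j\<in>X - {x}. (a j)\<^sup>2) + (\<Sum>j\<in>X - {x}. (D \<tau> j)\<^sup>2)) / 2"
    by (simp add: sum.distrib flip: sum_divide_distrib)
  finally have "(\<Sum>j\<in>X - {x}. (a j)\<^sup>2) \<le> (\<Sum>j\<in>X - {x}. (D \<tau> j)\<^sup>2)"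
    by simp
  also have "\<dots> \<le> (\<Sum>j\<in>X - {x}. (\<kappa> * norm (y - x))\<^sup>2 * (c_nu / (\<kappa> * norm ((x + \<tau> *\<^sub>R (y - x)) - j)))\<^sup>2)"
  proof (rule sum_mono)
    fix j assume "j \<in> X - {x}"
    then have "\<bar>D \<tau> j\<bar>\<^sup>2 \<le> (\<kappa> * norm (y - x) * (c_nu / (\<kappa> * norm ((x + \<tau> *\<^sub>R (y - x)) - j))))\<^sup>2"
      using D(2) \<tau> by (intro power_mono) auto
    then show "(D \<tau> j)\<^sup>2 \<le> (\<kappa> * norm (y - x))\<^sup>2 * (c_nu / (\<kappa> * norm ((x + \<tau> *\<^sub>R (y - x)) - j)))\<^sup>2"
      by (simp only: power2_abs power_mult_distrib)
  qed
  also have "\<dots> \<le> (\<kappa> * norm (y - x))\<^sup>2 * nu_bar s \<mu>"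
    unfolding sum_distrib_left[symmetric]
    using far_points(2)[OF x near, of \<tau>] \<tau> by (intro mult_left_mono) auto
  finally show ?thesis
    by (simp add: a_def S_def)
qed

text \<open>The left side is the relative loss, compared with \<open>t\<^sup>2 / 3\<close>, in the
  squared residual of a difference of two waves at scaled distance \<open>t\<close>.\<close>

lemma C2_bar_ge:
  assumes "0 \<le> t" "t \<le> \<gamma>"
  shows "t\<^sup>2 / 20 + (t\<^sup>2 / 12 + 3 * nu_bar s \<mu>) / (1 - \<mu>) \<le> 3 / 2 * C2_bar s \<gamma> \<mu>" and "0 \<le> C2_bar s \<gamma> \<mu>"
proof -
  define m where "m = \<mu> / (1 - \<mu>)"
  define \<nu> where "\<nu> = nu_bar s \<mu>"
  have m: "0 \<le> m" "0 \<le> \<nu>" "t\<^sup>2 \<le> \<gamma>\<^sup>2"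
    using pos assms by (auto simp: m_def \<nu>_def nu_bar_def intro: power_mono)
  \<comment> \<open>The two square roots in \<open>C1_bar\<close> are bounded below by
    \<open>1\<close> and by the root of the first square, which leaves a polynomial lower
    bound.\<close>
  have "1 / 3 + \<gamma>\<^sup>2 / 10 \<le> sqrt ((1 / 3 + \<gamma>\<^sup>2 / 10)\<^sup>2 + 4 * \<nu>)"
    using m by (intro real_le_rsqrt) simp
  also have "\<dots> \<le> sqrt (1 + \<nu>) * sqrt ((1 / 3 + \<gamma>\<^sup>2 / 10)\<^sup>2 + 4 * \<nu>)"
    using m mult_right_mono[of 1 "sqrt (1 + \<nu>)" "sqrt ((1 / 3 + \<gamma>\<^sup>2 / 10)\<^sup>2 + 4 * \<nu>)"] by simp
  finally have C1: "\<gamma>\<^sup>2 / 9 + \<nu> + 1 / 3 + \<gamma>\<^sup>2 / 10 \<le> C1_bar s \<gamma> \<mu>"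
    unfolding C1_bar_def \<nu>_def by linarith
  have C2: "C2_bar s \<gamma> \<mu> = 8 * \<gamma>\<^sup>2 / 15 + 6 * \<nu> + 2 * (m * C1_bar s \<gamma> \<mu>)"
    by (simp add: C2_bar_def m_def \<nu>_def)
  \<comment> \<open>Writing \<open>1 / (1 - \<mu>)\<close> as \<open>1 + m\<close> matches the term
    \<open>2 * (m * C1_bar s \<gamma> \<mu>)\<close> of \<open>C2_bar\<close>.\<close>
  have eq: "(t\<^sup>2 / 12 + 3 * \<nu>) / (1 - \<mu>) = (t\<^sup>2 / 12 + 3 * \<nu>) + m * (t\<^sup>2 / 12 + 3 * \<nu>)"
    using pos by (simp add: m_def field_simps)
  have m_le: "m * (t\<^sup>2 / 12 + 3 * \<nu>) \<le> m * (3 * C1_bar s \<gamma> \<mu>)"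
  proof (rule mult_left_mono[OF _ m(1)])
    show "t\<^sup>2 / 12 + 3 * \<nu> \<le> 3 * C1_bar s \<gamma> \<mu>"
      using C1 m(3) zero_le_power2[of \<gamma>] by linarith
  qed
  show "t\<^sup>2 / 20 + (t\<^sup>2 / 12 + 3 * nu_bar s \<mu>) / (1 - \<mu>) \<le> 3 / 2 * C2_bar s \<gamma> \<mu>"
  proof -
    have "x / 20 + (x / 12 + 3 * \<nu> + M) \<le> 3 / 2 * (8 * g / 15 + 6 * \<nu> + 2 * W)"
      if "M \<le> 3 * W" "x \<le> g" "0 \<le> g" for x g M W
      using that m(2) by argo
    from this[of "m * (t\<^sup>2 / 12 + 3 * \<nu>)" "m * C1_bar s \<gamma> \<mu>" "t\<^sup>2" "\<gamma>\<^sup>2"] show ?thesis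
      using m(3) m_le by (simp only: C2 \<nu>_def[symmetric] eq mult.left_commute[of m 3] zero_le_power2 simp_thms)
  qed
  have "0 \<le> C1_bar s \<gamma> \<mu>"
    using C1 m zero_le_power2[of \<gamma>] by linarith
  then show "0 \<le> C2_bar s \<gamma> \<mu>"
    using m by (simp add: C2)
qed

text \<open>As the wave of \<open>x\<close> lies in the space, it may be subtracted from the wave of
  \<open>y\<close>. The squared norm of the difference \<open>f\<close> is at least
  \<open>t\<^sup>2 / 3 - t ^ 4 / 60\<close>, while its projection is small: the inner product with
  the wave of \<open>x\<close> is of order \<open>t\<^sup>2\<close>, and those with the others are
  controlled by \<open>sinc_increments\<close>.\<close>

lemma residual_near:
  assumes C2: "C2_bar s \<gamma> \<mu> < 2 / 3" and x: "x \<in> X" and y: "norm (y - x) \<le> \<gamma> / \<kappa>"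
  shows "sqrt 3 / 2 * (2 / 3 - C2_bar s \<gamma> \<mu>) * (\<kappa> * norm (y - x))
    \<le> l2_norm (\<lambda>\<omega>. plane_wave \<kappa> y \<omega> - orth_proj (wave_space \<kappa> X) (plane_wave \<kappa> y) \<omega>)"
proof -
  let ?P = "orth_proj (wave_space \<kappa> X)"
  define t where "t = \<kappa> * norm (y - x)"
  define f where "f = (\<lambda>\<omega>. plane_wave \<kappa> y \<omega> - plane_wave \<kappa> x \<omega>)"
  \<comment> \<open>Chosen so that \<open>1 - q\<close> is \<open>3 / 2\<close> times
    \<open>2 / 3 - C2_bar s \<gamma> \<mu>\<close>; the asserted constant is then
    \<open>(1 - q) / sqrt 3\<close>.\<close>
  define q where "q = 3 / 2 * C2_bar s \<gamma> \<mu>"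
  define \<nu> where "\<nu> = nu_bar s \<mu>"
  define E where "E = l2_norm (\<lambda>\<omega>. plane_wave \<kappa> y \<omega> - ?P (plane_wave \<kappa> y) \<omega>)"
  have t: "0 \<le> t" "t \<le> \<gamma>"
    using y pos by (simp_all add: t_def pos_le_divide_eq mult.commute)
  have f: "f \<in> L2"
    unfolding f_def by (intro L2_diff plane_wave_L2)
  \<comment> \<open>Minimality replaces linearity of the projector, which as a choice of
    representatives is determined only almost everywhere.\<close>
  have "(\<lambda>\<omega>. ?P (plane_wave \<kappa> y) \<omega> - plane_wave \<kappa> x \<omega>) \<in> wave_space \<kappa> X"
    by (intro wave_space_diff orth_proj_wave_space(1) plane_wave_in_wave_space finite_X plane_wave_L2 x)
  then have "l2_norm (\<lambda>\<omega>. f \<omega> - ?P f \<omega>) \<le> l2_norm (\<lambda>\<omega>. f \<omega> - (?P (plane_wave \<kappa> y) \<omega> - plane_wave \<kappa> x \<omega>))"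
    by (rule orth_proj_minimal[OF finite_X f])
  then have "l2_norm (\<lambda>\<omega>. f \<omega> - ?P f \<omega>) \<le> E"
    by (simp add: f_def E_def)
  then have E: "(l2_norm (\<lambda>\<omega>. f \<omega> - ?P f \<omega>))\<^sup>2 \<le> E\<^sup>2"
    by (intro power_mono l2_norm_nonneg)
  have inner: "l2_inner f (plane_wave \<kappa> j) = of_real (sinc (\<kappa> * norm (y - j)) - sinc (\<kappa> * norm (x - j)))" for j
    by (simp add: f_def l2_inner_diff_left plane_wave_L2 l2_inner_plane_wave pos(1))
  have "(\<Sum>j\<in>X. (cmod (l2_inner f (plane_wave \<kappa> j)))\<^sup>2)
      = (\<Sum>j\<in>X. (sinc (\<kappa> * norm (y - j)) - sinc (\<kappa> * norm (x - j)))\<^sup>2)"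
    unfolding inner norm_of_real by simp
  also have "\<dots> = (sinc t - 1)\<^sup>2 + (\<Sum>j\<in>X - {x}. (sinc (\<kappa> * norm (y - j)) - sinc (\<kappa> * norm (x - j)))\<^sup>2)"
    using sum.remove[OF finite_X x, of "\<lambda>j. (sinc (\<kappa> * norm (y - j)) - sinc (\<kappa> * norm (x - j)))\<^sup>2"]
    by (simp add: t_def sinc_def)
  also have "\<dots> \<le> (t\<^sup>2 / 6)\<^sup>2 + t\<^sup>2 * \<nu>"
  proof (rule add_mono)
    have "\<bar>sinc t - 1\<bar> \<le> t\<^sup>2 / 6"
      using sinc_ge[OF t(1)] abs_sinc_le_one[of t] by linarith
    then show "(sinc t - 1)\<^sup>2 \<le> (t\<^sup>2 / 6)\<^sup>2"
      using power_mono[of "\<bar>sinc t - 1\<bar>" _ 2] by simp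
  qed (use sinc_increments[OF x y] in \<open>simp add: t_def \<nu>_def\<close>)
  finally have "(l2_norm (?P f))\<^sup>2 \<le> ((t\<^sup>2 / 6)\<^sup>2 + t\<^sup>2 * \<nu>) / (1 - \<mu>)"
    using projection_norm_le[OF f] pos(4) by (meson diff_ge_0_iff_ge divide_right_mono less_imp_le order_trans)
  moreover have "(l2_norm f)\<^sup>2 = 2 * (1 - sinc t)"
    unfolding f_def t_def by (rule l2_norm_plane_wave_diff[OF pos(1)])
  ultimately have "t\<^sup>2 / 3 - t ^ 4 / 60 - ((t\<^sup>2 / 6)\<^sup>2 + t\<^sup>2 * \<nu>) / (1 - \<mu>) \<le> E\<^sup>2"
    using orth_proj_norm[OF finite_X f, where \<kappa> = \<kappa>] sinc_le[OF t(1)] E by simp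
  moreover have "t\<^sup>2 / 3 - t ^ 4 / 60 - ((t\<^sup>2 / 6)\<^sup>2 + t\<^sup>2 * \<nu>) / (1 - \<mu>)
      = t\<^sup>2 / 3 * (1 - (t\<^sup>2 / 20 + (t\<^sup>2 / 12 + 3 * \<nu>) / (1 - \<mu>)))"
  proof -
    have "((t\<^sup>2 / 6)\<^sup>2 + t\<^sup>2 * \<nu>) / (1 - \<mu>) = t\<^sup>2 / 3 * ((t\<^sup>2 / 12 + 3 * \<nu>) / (1 - \<mu>))"
      by (simp add: power2_eq_square algebra_simps)
    moreover have "t ^ 4 = t\<^sup>2 * t\<^sup>2"
      by (simp flip: power_add)
    moreover have "a / 3 - a * a / 60 - a / 3 * c = a / 3 * (1 - (a / 20 + c))" for a c :: real
      by (simp add: algebra_simps)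
    ultimately show ?thesis
      by (simp only:)
  qed
  moreover have "t\<^sup>2 / 3 * (1 - q)\<^sup>2 \<le> t\<^sup>2 / 3 * (1 - (t\<^sup>2 / 20 + (t\<^sup>2 / 12 + 3 * \<nu>) / (1 - \<mu>)))"
  proof (rule mult_left_mono)
    \<comment> \<open>On the unit interval \<open>1 - q\<close> dominates its square, so the bound
      takes the form of a perfect square and the root can be extracted.\<close>
    have "0 \<le> q" "q \<le> 1"
      using C2 C2_bar_ge(2)[OF t] by (simp_all add: q_def)
    then have "(1 - q)\<^sup>2 \<le> 1 - q"
      by (simp add: power2_eq_square mult_left_le_one_le)
    then show "(1 - q)\<^sup>2 \<le> 1 - (t\<^sup>2 / 20 + (t\<^sup>2 / 12 + 3 * \<nu>) / (1 - \<mu>))"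
      using C2_bar_ge(1)[OF t] unfolding q_def \<nu>_def by linarith
  qed simp
  ultimately have "t\<^sup>2 / 3 * (1 - q)\<^sup>2 \<le> E\<^sup>2"
    by linarith
  moreover have "(sqrt 3 / 2 * (2 / 3 - C2_bar s \<gamma> \<mu>) * t)\<^sup>2 = t\<^sup>2 / 3 * (1 - q)\<^sup>2"
  proof -
    have eq: "sqrt 3 / 2 * (2 / 3 - C2_bar s \<gamma> \<mu>) * t = sqrt 3 / 3 * ((1 - q) * t)"
      by (simp add: q_def algebra_simps)
    show ?thesis
      unfolding eq power_mult_distrib power_divide by simp
  qed
  ultimately have "(sqrt 3 / 2 * (2 / 3 - C2_bar s \<gamma> \<mu>) * t)\<^sup>2 \<le> E\<^sup>2"
    by (simp only:)
  then have "sqrt 3 / 2 * (2 / 3 - C2_bar s \<gamma> \<mu>) * t \<le> E"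
    by (rule power2_le_imp_le) (simp add: E_def l2_norm_nonneg)
  then show ?thesis
    by (simp add: t_def E_def)
qed

end

section \<open>Distance of the projectors\<close>

text \<open>Both residuals have norm at most \<open>1\<close>, so the projections differ by at most
  \<open>2\<close>. This makes the supremum in \<open>op_norm\<close> genuine.\<close>

lemma d_sp_bdd_above:
  assumes "finite X" "finite Y"
  shows "bdd_above ((\<lambda>f. l2_norm (\<lambda>\<omega>. orth_proj (wave_space \<kappa> X) f \<omega> - orth_proj (wave_space \<kappa> Y) f \<omega>))
    ` {f \<in> L2. l2_norm f \<le> 1})"
proof (rule bdd_aboveI2)
  fix f assume "f \<in> {f \<in> L2. l2_norm f \<le> 1}"
  then have f: "f \<in> L2" "l2_norm f \<le> 1"
    by auto
  let ?P = "orth_proj (wave_space \<kappa> X) f" and ?Q = "orth_proj (wave_space \<kappa> Y) f"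
  have res: "l2_norm (\<lambda>\<omega>. f \<omega> - orth_proj (wave_space \<kappa> Z) f \<omega>) \<le> 1" if "finite Z" for Z
    using orth_proj_minimal[OF that f(1) zero_wave_space[of \<kappa>]] f(2) by simp
  have "l2_norm (\<lambda>\<omega>. (f \<omega> - ?Q \<omega>) + (?P \<omega> - f \<omega>)) \<le> l2_norm (\<lambda>\<omega>. f \<omega> - ?Q \<omega>) + l2_norm (\<lambda>\<omega>. ?P \<omega> - f \<omega>)"
    using assms f by (intro l2_triangle L2_diff orth_proj_L2)
  also have "\<dots> \<le> 1 + 1"
    using res[OF assms(1)] res[OF assms(2)] l2_norm_diff_commute[of f ?P] by (intro add_mono) simp_all
  finally show "l2_norm (\<lambda>\<omega>. ?P \<omega> - ?Q \<omega>) \<le> 2"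
    by (simp add: algebra_simps)
qed

lemma d_sp_commute: "d_sp \<kappa> X Y = d_sp \<kappa> Y X"
  unfolding d_sp_def op_norm_def by (subst l2_norm_diff_commute) simp

text \<open>The wave of \<open>y\<close> is a unit vector fixed, up to a null set, by the projector
  of \<open>Y\<close>; testing the operator norm on it leaves the residual with respect to
  \<open>X\<close>.\<close>

lemma d_sp_ge_residual:
  assumes "finite X" "finite Y" "0 < \<kappa>" "y \<in> Y"
  shows "l2_norm (\<lambda>\<omega>. plane_wave \<kappa> y \<omega> - orth_proj (wave_space \<kappa> X) (plane_wave \<kappa> y) \<omega>) \<le> d_sp \<kappa> X Y"
proof -
  let ?f = "plane_wave \<kappa> y"
  let ?P = "orth_proj (wave_space \<kappa> X) ?f" and ?Q = "orth_proj (wave_space \<kappa> Y) ?f"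
  have L2: "?f \<in> L2" "?P \<in> L2" "?Q \<in> L2"
    using assms by (auto intro: plane_wave_L2 orth_proj_L2)
  have "l2_norm (\<lambda>\<omega>. ?f \<omega> - ?Q \<omega>) \<le> l2_norm (\<lambda>\<omega>. ?f \<omega> - ?f \<omega>)"
    using assms by (intro orth_proj_minimal L2 plane_wave_in_wave_space)
  then have "l2_norm (\<lambda>\<omega>. ?f \<omega> - ?Q \<omega>) \<le> 0"
    by (simp add: l2_norm_def)
  moreover have "l2_norm (\<lambda>\<omega>. (?f \<omega> - ?Q \<omega>) + (?Q \<omega> - ?P \<omega>)) \<le> l2_norm (\<lambda>\<omega>. ?f \<omega> - ?Q \<omega>) + l2_norm (\<lambda>\<omega>. ?Q \<omega> - ?P \<omega>)"
    by (intro l2_triangle L2_diff L2)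
  ultimately have "l2_norm (\<lambda>\<omega>. ?f \<omega> - ?P \<omega>) \<le> l2_norm (\<lambda>\<omega>. ?P \<omega> - ?Q \<omega>)"
    by (simp add: l2_norm_diff_commute[of ?P ?Q])
  also have "\<dots> \<le> d_sp \<kappa> X Y"
    unfolding d_sp_def op_norm_def
    using L2 assms(3) by (intro cSUP_upper[OF _ d_sp_bdd_above[OF assms(1,2)]]) (simp add: l2_norm_plane_wave)
  finally show ?thesis .
qed

text \<open>With \<open>p\<close> and \<open>q\<close> the projections of \<open>f\<close> to the two spaces and \<open>r\<close> the projection of \<open>p\<close>
  to the second one, \<open>p - q = (p - r) + (r - q)\<close> is an orthogonal decomposition; the first part
  is controlled by one gap, and the second one, by duality, by the other gap.\<close>

lemma d_sp_le_gap:
  assumes fin: "finite X" "finite Y" and g: "0 \<le> g"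
    and gapX: "\<And>u. u \<in> wave_space \<kappa> X \<Longrightarrow> l2_norm (\<lambda>\<omega>. u \<omega> - orth_proj (wave_space \<kappa> Y) u \<omega>) \<le> g * l2_norm u"
    and gapY: "\<And>u. u \<in> wave_space \<kappa> Y \<Longrightarrow> l2_norm (\<lambda>\<omega>. u \<omega> - orth_proj (wave_space \<kappa> X) u \<omega>) \<le> g * l2_norm u"
  shows "d_sp \<kappa> X Y \<le> g"
  unfolding d_sp_def op_norm_def
proof (rule cSUP_least)
  show "{f \<in> L2. l2_norm f \<le> 1} \<noteq> {}"
    using L2_zero by (auto simp: l2_norm_def intro!: exI[of _ "\<lambda>_. 0"])
  fix f assume "f \<in> {f \<in> L2. l2_norm f \<le> 1}"
  then have f: "f \<in> L2" "l2_norm f \<le> 1"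
    by auto
  define p where "p = orth_proj (wave_space \<kappa> X) f"
  define q where "q = orth_proj (wave_space \<kappa> Y) f"
  define r where "r = orth_proj (wave_space \<kappa> Y) p"
  define v where "v = (\<lambda>\<omega>. r \<omega> - q \<omega>)"
  define w where "w = orth_proj (wave_space \<kappa> X) v"
  have p: "p \<in> wave_space \<kappa> X" "p \<in> L2"
    using orth_proj_wave_space(1)[OF fin(1) f(1)] by (auto simp: p_def intro: wave_space_L2)
  have q: "q \<in> wave_space \<kappa> Y" "q \<in> L2"
    using orth_proj_wave_space(1)[OF fin(2) f(1)] by (auto simp: q_def intro: wave_space_L2)
  have r: "r \<in> wave_space \<kappa> Y" "r \<in> L2"
    using orth_proj_wave_space(1)[OF fin(2) p(2)] by (auto simp: r_def intro: wave_space_L2)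
  have v: "v \<in> wave_space \<kappa> Y" "v \<in> L2"
    using wave_space_diff[OF r(1) q(1)] by (auto simp: v_def intro: wave_space_L2)
  have w: "w \<in> wave_space \<kappa> X" "w \<in> L2"
    using orth_proj_wave_space(1)[OF fin(1) v(2)] by (auto simp: w_def intro: wave_space_L2)
  have orth: "l2_inner f v = l2_inner q v" "l2_inner p v = l2_inner r v" "l2_inner f w = l2_inner p w"
    using orth_proj_wave_space(2)[OF fin(2) f(1) v(1)] orth_proj_wave_space(2)[OF fin(2) p(2) v(1)]
      orth_proj_wave_space(2)[OF fin(1) f(1) w(1)] p q r v w f
    by (simp_all add: p_def[symmetric] q_def[symmetric] r_def[symmetric] l2_inner_diff_left)
  have "l2_inner v v = l2_inner r v - l2_inner q v"
    unfolding v_def using r q v by (intro l2_inner_diff_left) (simp_all add: L2_diff)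
  \<comment> \<open>Duality: \<open>v\<close> sees \<open>r - q\<close> as \<open>p - f\<close>, and
    since \<open>f - p\<close> is orthogonal to \<open>w\<close>, the vector \<open>v\<close> may be
    replaced by its residual \<open>v - w\<close>, which \<open>gapY\<close> controls.\<close>
  also have "\<dots> = - l2_inner (\<lambda>\<omega>. f \<omega> - p \<omega>) (\<lambda>\<omega>. v \<omega> - w \<omega>)"
    using f p v w orth by (simp add: l2_inner_diff_left l2_inner_diff_right L2_diff)
  finally have "(l2_norm v)\<^sup>2 \<le> cmod (l2_inner (\<lambda>\<omega>. f \<omega> - p \<omega>) (\<lambda>\<omega>. v \<omega> - w \<omega>))"
    unfolding l2_norm_power2_Re by (metis complex_Re_le_cmod norm_minus_cancel)
  also have "\<dots> \<le> l2_norm (\<lambda>\<omega>. f \<omega> - p \<omega>) * l2_norm (\<lambda>\<omega>. v \<omega> - w \<omega>)"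
    by (intro l2_Cauchy_Schwarz L2_diff f p v w)
  also have "\<dots> \<le> l2_norm (\<lambda>\<omega>. f \<omega> - p \<omega>) * (g * l2_norm v)"
    using gapY[OF v(1)] by (intro mult_left_mono) (simp_all add: w_def l2_norm_nonneg)
  finally have "l2_norm v * l2_norm v \<le> (g * l2_norm (\<lambda>\<omega>. f \<omega> - p \<omega>)) * l2_norm v"
    by (simp add: power2_eq_square mult_ac)
  then have v_le: "l2_norm v \<le> g * l2_norm (\<lambda>\<omega>. f \<omega> - p \<omega>)"
    using g l2_norm_nonneg[of v] l2_norm_nonneg[of "\<lambda>\<omega>. f \<omega> - p \<omega>"]
    by (cases "l2_norm v = 0") (simp_all add: mult_le_cancel_right)
  have "l2_inner (\<lambda>\<omega>. p \<omega> - r \<omega>) v = 0"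
    using orth_proj_wave_space(2)[OF fin(2) p(2) v(1)] by (simp add: r_def)
  then have "(l2_norm (\<lambda>\<omega>. (p \<omega> - r \<omega>) + v \<omega>))\<^sup>2 = (l2_norm (\<lambda>\<omega>. p \<omega> - r \<omega>))\<^sup>2 + (l2_norm v)\<^sup>2"
    using p r v by (subst l2_norm_add_power2) (simp_all add: L2_diff)
  also have "\<dots> \<le> (g * l2_norm p)\<^sup>2 + (g * l2_norm (\<lambda>\<omega>. f \<omega> - p \<omega>))\<^sup>2"
    using gapX[OF p(1)] v_le by (intro add_mono power_mono) (simp_all add: r_def l2_norm_nonneg)
  also have "\<dots> = g\<^sup>2 * (l2_norm f)\<^sup>2"
    using orth_proj_norm[OF fin(1) f(1), of \<kappa>] by (simp add: p_def power_mult_distrib distrib_left)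
  also have "\<dots> \<le> g\<^sup>2"
    using f(2) l2_norm_nonneg[of f] by (simp add: mult_left_le power_le_one)
  finally have "(l2_norm (\<lambda>\<omega>. p \<omega> - q \<omega>))\<^sup>2 \<le> g\<^sup>2"
    by (simp add: v_def)
  then show "l2_norm (\<lambda>\<omega>. orth_proj (wave_space \<kappa> X) f \<omega> - orth_proj (wave_space \<kappa> Y) f \<omega>) \<le> g"
    using g unfolding p_def q_def by (rule power2_le_imp_le)
qed

text \<open>Each wave of \<open>u\<close> is replaced by the wave of the partner point, at a cost of
  at most \<open>\<kappa> * d / sqrt 3\<close> per unit of coefficient. The Cauchy-Schwarz
  inequality and the Gram bound convert the sum of the coefficients into
  \<open>l2_norm u\<close>.\<close>

lemma (in config) gap_le:
  assumes "finite Y" "0 \<le> d" and p: "\<And>x. x \<in> X \<Longrightarrow> p x \<in> Y \<and> norm (x - p x) \<le> d"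
    and u: "u \<in> wave_space \<kappa> X"
  shows "l2_norm (\<lambda>\<omega>. u \<omega> - orth_proj (wave_space \<kappa> Y) u \<omega>) \<le> \<kappa> * sqrt s / sqrt (3 * (1 - \<mu>)) * d * l2_norm u"
proof -
  obtain a where a: "u = (\<lambda>\<omega>. \<Sum>x\<in>X. a x * plane_wave \<kappa> x \<omega>)"
    using u by (auto simp: wave_space_def)
  define v where "v = (\<lambda>\<omega>. \<Sum>x\<in>X. a x * plane_wave \<kappa> (p x) \<omega>)"
  \<comment> \<open>\<open>p\<close> is not assumed injective, so coefficients of points with a
    common image are added.\<close>
  have "v = (\<lambda>\<omega>. \<Sum>y\<in>Y. (\<Sum>x\<in>{x\<in>X. p x = y}. a x) * plane_wave \<kappa> y \<omega>)"
  proof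
    fix \<omega>
    have "v \<omega> = (\<Sum>y\<in>Y. \<Sum>x\<in>{x\<in>X. p x = y}. a x * plane_wave \<kappa> (p x) \<omega>)"
      unfolding v_def using p by (subst sum.group) (auto simp: finite_X assms(1))
    also have "\<dots> = (\<Sum>y\<in>Y. (\<Sum>x\<in>{x\<in>X. p x = y}. a x) * plane_wave \<kappa> y \<omega>)"
      by (simp add: sum_distrib_right)
    finally show "v \<omega> = (\<Sum>y\<in>Y. (\<Sum>x\<in>{x\<in>X. p x = y}. a x) * plane_wave \<kappa> y \<omega>)" .
  qed
  then have v: "v \<in> wave_space \<kappa> Y"
    unfolding wave_space_def by (intro CollectI exI[of _ "\<lambda>y. \<Sum>x | x \<in> X \<and> p x = y. a x"] conjI TrueI)
  have "l2_norm (\<lambda>\<omega>. u \<omega> - orth_proj (wave_space \<kappa> Y) u \<omega>) \<le> l2_norm (\<lambda>\<omega>. u \<omega> - v \<omega>)"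
    using u by (intro orth_proj_minimal assms(1) v wave_space_L2)
  also have "(\<lambda>\<omega>. u \<omega> - v \<omega>) = (\<lambda>\<omega>. \<Sum>x\<in>X. a x * (plane_wave \<kappa> x \<omega> - plane_wave \<kappa> (p x) \<omega>))"
    by (simp add: a v_def sum_subtractf right_diff_distrib)
  also have "l2_norm \<dots> \<le> (\<Sum>x\<in>X. l2_norm (\<lambda>\<omega>. a x * (plane_wave \<kappa> x \<omega> - plane_wave \<kappa> (p x) \<omega>)))"
    by (intro l2_norm_sum L2_cmult L2_diff plane_wave_L2)
  also have "\<dots> \<le> (\<Sum>x\<in>X. cmod (a x) * (\<kappa> * d / sqrt 3))"
    unfolding l2_norm_cmult
  proof (intro sum_mono mult_left_mono)
    fix x assume "x \<in> X"
    have "l2_norm (\<lambda>\<omega>. plane_wave \<kappa> x \<omega> - plane_wave \<kappa> (p x) \<omega>) \<le> \<kappa> * norm (x - p x) / sqrt 3"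
      by (rule l2_norm_plane_wave_diff_le[OF pos(1)])
    also have "\<dots> \<le> \<kappa> * d / sqrt 3"
      using p[OF \<open>x \<in> X\<close>] pos(1) by (intro divide_right_mono mult_left_mono) simp_all
    finally show "l2_norm (\<lambda>\<omega>. plane_wave \<kappa> x \<omega> - plane_wave \<kappa> (p x) \<omega>) \<le> \<kappa> * d / sqrt 3" .
  qed simp
  also have "\<dots> = (\<Sum>x\<in>X. cmod (a x)) * (\<kappa> * d / sqrt 3)"
    by (rule sum_distrib_right[symmetric])
  also have "\<dots> \<le> (sqrt s * (l2_norm u / sqrt (1 - \<mu>))) * (\<kappa> * d / sqrt 3)"
  proof (rule mult_right_mono)
    have "(\<Sum>x\<in>X. cmod (a x))\<^sup>2 \<le> (\<Sum>x\<in>X. (cmod (a x))\<^sup>2) * s"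
      using sum_squared_le_sum_of_squares[of "\<lambda>x. cmod (a x)" X] by (simp add: card_X)
    also have "(\<Sum>x\<in>X. (cmod (a x))\<^sup>2) \<le> (l2_norm u)\<^sup>2 / (1 - \<mu>)"
      using Gram_lower_bound[OF finite_X pos(1) Gershgorin, of a] pos(4)
      by (simp add: a pos_le_divide_eq mult.commute)
    also have "(l2_norm u)\<^sup>2 / (1 - \<mu>) * s = (sqrt s * (l2_norm u / sqrt (1 - \<mu>)))\<^sup>2"
      using pos(4) by (simp add: power_mult_distrib power_divide)
    finally show "(\<Sum>x\<in>X. cmod (a x)) \<le> sqrt s * (l2_norm u / sqrt (1 - \<mu>))"
      using pos(4) by (intro power2_le_imp_le[of "sum _ _"]) (simp_all add: l2_norm_nonneg mult_right_mono)
    show "0 \<le> \<kappa> * d / sqrt 3"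
      using pos assms(2) by simp
  qed
  also have "\<dots> = \<kappa> * sqrt s / sqrt (3 * (1 - \<mu>)) * d * l2_norm u"
    unfolding real_sqrt_mult by (simp add: mult_ac)
  finally show ?thesis .
qed

section \<open>From projectors to matchings and back\<close>

text \<open>Unpacks the minimum of maxima: an optimal matching exists, and any matching with all
  displacements at most \<open>c\<close> bounds \<open>d_match\<close> by \<open>c\<close>.\<close>

lemma d_match_witness:
  assumes "finite X" "finite Y" "card X = card Y" "X \<noteq> {}"
  obtains p where "bij_betw p X Y" "\<And>x. x \<in> X \<Longrightarrow> norm (x - p x) \<le> d_match X Y"
    and "\<And>p' c. bij_betw p' X Y \<Longrightarrow> (\<And>x. x \<in> X \<Longrightarrow> norm (x - p' x) \<le> c) \<Longrightarrow> d_match X Y \<le> c"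
proof -
  define M where "M = {Max ((\<lambda>x. norm (x - p x)) ` X) | p. bij_betw p X Y}"
  have le: "norm (x - p x) \<le> Max ((\<lambda>x. norm (x - p x)) ` X)" if "x \<in> X" for p x
    using that assms(1) by (intro Max_ge) auto
  \<comment> \<open>Bijections are unrestricted off \<open>X\<close>, so there can be infinitely
    many; each maximum, however, is one of the finitely many distances between the two sets.\<close>
  have "M \<subseteq> (\<lambda>(x, y). norm (x - y)) ` (X \<times> Y)"
  proof
    fix m assume "m \<in> M"
    then obtain p where p: "bij_betw p X Y" "m = Max ((\<lambda>x. norm (x - p x)) ` X)"
      by (auto simp: M_def)
    have "m \<in> (\<lambda>x. norm (x - p x)) ` X"
      unfolding p(2) using assms by (intro Max_in) auto
    then show "m \<in> (\<lambda>(x, y). norm (x - y)) ` (X \<times> Y)"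
      using bij_betwE[OF p(1)] by auto
  qed
  then have fin: "finite M"
    by (rule finite_subset) (use assms in simp)
  have "M \<noteq> {}"
    using finite_same_card_bij[OF assms(1-3)] by (auto simp: M_def)
  then have "d_match X Y \<in> M"
    unfolding d_match_def M_def[symmetric] using fin by (rule Min_in[rotated])
  then obtain p where p: "bij_betw p X Y" "d_match X Y = Max ((\<lambda>x. norm (x - p x)) ` X)"
    by (auto simp: M_def)
  show ?thesis
  proof (rule that[OF p(1)])
    show "norm (x - p x) \<le> d_match X Y" if "x \<in> X" for x
      unfolding p(2) by (rule le[OF that])
    fix p' c assume p': "bij_betw p' X Y" "\<And>x. x \<in> X \<Longrightarrow> norm (x - p' x) \<le> c"
    have "d_match X Y \<le> Max ((\<lambda>x. norm (x - p' x)) ` X)"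
      unfolding d_match_def M_def[symmetric] using p'(1) fin by (intro Min_le) (auto simp: M_def)
    also have "\<dots> \<le> c"
      using assms p'(2) by (intro Max.boundedI) auto
    finally show "d_match X Y \<le> c" .
  qed
qed

locale two_configs = X: config s \<kappa> \<gamma> \<mu> X + Y: config s \<kappa> \<gamma> \<mu> Y
  for s :: nat and \<kappa> \<gamma> \<mu> :: real and X Y :: "(real^3) set"
begin

lemma nonempty: "X \<noteq> {}"
  using X.card_X X.s by auto

text \<open>An optimal matching bounds the gap from \<open>X\<close> to \<open>Y\<close>, and its
  inverse the gap from \<open>Y\<close> to \<open>X\<close>.\<close>

lemma upper_bound: "d_sp \<kappa> X Y \<le> \<kappa> * sqrt s / sqrt (3 * (1 - \<mu>)) * d_match X Y"
proof -
  obtain p where p: "bij_betw p X Y" "\<And>x. x \<in> X \<Longrightarrow> norm (x - p x) \<le> d_match X Y"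
    using d_match_witness[OF X.finite_X Y.finite_X _ nonempty] X.card_X Y.card_X by metis
  define p' where "p' = inv_into X p"
  obtain x where "x \<in> X"
    using nonempty by auto
  then have nonneg: "0 \<le> d_match X Y"
    using p(2) norm_ge_zero order_trans by blast
  have XY: "p x \<in> Y \<and> norm (x - p x) \<le> d_match X Y" if "x \<in> X" for x
    using p that bij_betwE by blast
  have YX: "p' y \<in> X \<and> norm (y - p' y) \<le> d_match X Y" if "y \<in> Y" for y
  proof -
    have "p' y \<in> X" "p (p' y) = y"
      using p(1) that by (auto simp: p'_def bij_betw_def intro: inv_into_into f_inv_into_f)
    then show ?thesis
      using p(2)[of "p' y"] by (simp add: norm_minus_commute)
  qed
  show ?thesis
    using X.pos nonneg X.gap_le[OF Y.finite_X nonneg XY] Y.gap_le[OF X.finite_X nonneg YX]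
    by (intro d_sp_le_gap[OF X.finite_X Y.finite_X]) simp_all
qed

lemma d_sp_ge:
  "y \<in> Y \<Longrightarrow> l2_norm (\<lambda>\<omega>. plane_wave \<kappa> y \<omega> - orth_proj (wave_space \<kappa> X) (plane_wave \<kappa> y) \<omega>) \<le> d_sp \<kappa> X Y"
  by (rule d_sp_ge_residual[OF X.finite_X Y.finite_X X.pos(1)])

lemma d_sp_nonneg: "0 \<le> d_sp \<kappa> X Y"
proof -
  obtain y where "y \<in> Y"
    using Y.card_X Y.s by fastforce
  from l2_norm_nonneg d_sp_ge[OF this] show ?thesis
    by (rule order_trans)
qed

text \<open>Otherwise \<open>residual_far\<close> makes the residual of the wave of
  \<open>y\<close>, and with it \<open>d_sp\<close>, too large.\<close>

lemma close_point:
  assumes "(d_sp \<kappa> X Y)\<^sup>2 < A_star s \<gamma> \<mu>" "y \<in> Y"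
  shows "\<exists>x\<in>X. norm (y - x) < \<gamma> / \<kappa>"
proof (rule ccontr)
  assume "\<not> ?thesis"
  then have "A_star s \<gamma> \<mu> \<le> (l2_norm (\<lambda>\<omega>. plane_wave \<kappa> y \<omega> - orth_proj (wave_space \<kappa> X) (plane_wave \<kappa> y) \<omega>))\<^sup>2"
    by (intro X.residual_far) (auto simp: not_less)
  also have "\<dots> \<le> (d_sp \<kappa> X Y)\<^sup>2"
    by (intro power_mono d_sp_ge assms l2_norm_nonneg)
  finally show False
    using assms(1) by simp
qed

lemma close_point_unique:
  assumes "x \<in> X" "x' \<in> X" "norm (z - x) < \<gamma> / \<kappa>" "norm (z - x') < \<gamma> / \<kappa>"
  shows "x = x'"
proof (rule ccontr)
  assume "x \<noteq> x'"
  then have "min_sep X \<le> norm (x - x')"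
    using assms X.separation(2) by simp
  moreover have "norm (x - x') \<le> norm (z - x') + norm (z - x)"
    using norm_triangle_ineq4[of "z - x'" "z - x"] by simp
  ultimately show False
    using assms(3,4) X.radius_le by linarith
qed

end

context two_configs
begin

text \<open>Makes the facts above available with the two configurations exchanged;
  \<open>d_sp\<close> is symmetric.\<close>

interpretation YX: two_configs s \<kappa> \<gamma> \<mu> Y X ..

text \<open>Every point has a partner closer than \<open>\<gamma> / \<kappa>\<close> in the other
  set. Twice this radius is at most the separation, so partners are unique: uniqueness in
  \<open>X\<close> gives injectivity, uniqueness in \<open>Y\<close> surjectivity.\<close>

lemma close_matching:
  assumes "(d_sp \<kappa> X Y)\<^sup>2 < A_star s \<gamma> \<mu>"
  obtains p where "bij_betw p X Y" "\<And>x. x \<in> X \<Longrightarrow> norm (x - p x) < \<gamma> / \<kappa>"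
proof -
  have "\<forall>x\<in>X. \<exists>y\<in>Y. norm (x - y) < \<gamma> / \<kappa>"
    using YX.close_point assms by (simp add: d_sp_commute[of \<kappa> Y X])
  then obtain p where p: "\<And>x. x \<in> X \<Longrightarrow> p x \<in> Y" "\<And>x. x \<in> X \<Longrightarrow> norm (x - p x) < \<gamma> / \<kappa>"
    by metis
  have "inj_on p X"
  proof (rule inj_onI)
    fix x x' assume "x \<in> X" "x' \<in> X" "p x = p x'"
    then show "x = x'"
      using p(2)[of x] p(2)[of x'] close_point_unique[of x x' "p x"] by (simp add: norm_minus_commute)
  qed
  moreover have "p ` X = Y"
  proof
    show "Y \<subseteq> p ` X"
    proof
      fix y assume y: "y \<in> Y"
      then obtain x where x: "x \<in> X" "norm (y - x) < \<gamma> / \<kappa>"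
        using close_point[OF assms] by blast
      then have "y = p x"
        using p[of x] y by (intro YX.close_point_unique[of y "p x" x]) (simp_all add: norm_minus_commute)
      then show "y \<in> p ` X"
        using x by simp
    qed
  qed (use p in auto)
  ultimately show ?thesis
    using p(2) by (intro that[of p]) (simp_all add: bij_betw_def)
qed

text \<open>Along the close matching, each displacement is bounded by the residual of one wave and
  hence by \<open>d_sp\<close>; the matching need not be optimal, as \<open>d_match\<close> is a
  minimum.\<close>

lemma lower_bound:
  assumes "C2_bar s \<gamma> \<mu> < 2 / 3" "(d_sp \<kappa> X Y)\<^sup>2 < A_star s \<gamma> \<mu>"
  shows "sqrt 3 / 2 * (2 / 3 - C2_bar s \<gamma> \<mu>) * (\<kappa> * d_match X Y) \<le> d_sp \<kappa> X Y"
proof -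
  define c where "c = sqrt 3 / 2 * (2 / 3 - C2_bar s \<gamma> \<mu>) * \<kappa>"
  have c: "0 < c"
    using assms(1) X.pos by (simp add: c_def)
  obtain p where p: "bij_betw p X Y" "\<And>x. x \<in> X \<Longrightarrow> norm (x - p x) < \<gamma> / \<kappa>"
    by (rule close_matching[OF assms(2)]) blast
  have "norm (x - p x) \<le> d_sp \<kappa> X Y / c" if x: "x \<in> X" for x
  proof -
    have "p x \<in> Y"
      using p(1) x bij_betwE by blast
    have "norm (p x - x) \<le> \<gamma> / \<kappa>"
      using p(2)[OF x] by (simp add: norm_minus_commute)
    from X.residual_near[OF assms(1) x this] d_sp_ge[OF \<open>p x \<in> Y\<close>]
    have "c * norm (x - p x) \<le> d_sp \<kappa> X Y"
      by (simp add: c_def norm_minus_commute mult.assoc)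
    then show ?thesis
      using c by (simp add: pos_le_divide_eq mult.commute)
  qed
  then have "d_match X Y \<le> d_sp \<kappa> X Y / c"
    using d_match_witness[OF X.finite_X Y.finite_X _ nonempty] X.card_X Y.card_X p(1) by metis
  then show ?thesis
    using c by (simp add: c_def pos_le_divide_eq mult_ac)
qed

end

section \<open>The thresholds and the final bounds\<close>

text \<open>\<open>A_star\<close> is at most \<open>1\<close>, so the arcsine is an angle in the
  first quadrant, where halving the angle decreases the sine.\<close>

lemma eta_gap_le:
  assumes "0 < A_star s \<gamma> \<mu>" "0 < \<gamma>" "0 \<le> \<mu>" "\<mu> < 1"
  shows "(eta_gap s \<gamma> \<mu>)\<^sup>2 \<le> A_star s \<gamma> \<mu>"
proof -
  define \<theta> where "\<theta> = arcsin (sqrt (A_star s \<gamma> \<mu>))"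
  have "0 \<le> nu_bar s \<mu>"
    by (simp add: nu_bar_def)
  have "b_const \<gamma> - \<mu> - nu_bar s \<mu> \<le> 1 - \<mu>"
    using b_const_le_one[OF assms(2)] \<open>0 \<le> nu_bar s \<mu>\<close> by linarith
  then have "A_star s \<gamma> \<mu> \<le> 1"
    using assms by (simp add: A_star_def)
  then have A: "0 \<le> sqrt (A_star s \<gamma> \<mu>)" "- 1 \<le> sqrt (A_star s \<gamma> \<mu>)" "sqrt (A_star s \<gamma> \<mu>) \<le> 1"
    using assms(1) order_trans[of "-1" 0 "sqrt (A_star s \<gamma> \<mu>)"] by simp_all
  then have "0 \<le> \<theta>" "\<theta> \<le> pi / 2" and sin: "sin \<theta> = sqrt (A_star s \<gamma> \<mu>)"
    using arcsin_le_arcsin[of 0 "sqrt (A_star s \<gamma> \<mu>)"] arcsin_bounded[OF A(2,3)]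
    by (simp_all add: \<theta>_def)
  moreover have eta: "eta_gap s \<gamma> \<mu> = sin (\<theta> / 2)"
    by (simp add: eta_gap_def \<theta>_def)
  ultimately have "0 \<le> eta_gap s \<gamma> \<mu>"
    using pi_gt_zero by (simp add: sin_ge_zero)
  have "sin (\<theta> / 2) \<le> sin \<theta>"
    using \<open>0 \<le> \<theta>\<close> \<open>\<theta> \<le> pi / 2\<close> by (intro sin_monotone_2pi_le) simp_all
  then have "eta_gap s \<gamma> \<mu> \<le> sqrt (A_star s \<gamma> \<mu>)"
    unfolding eta sin .
  then show ?thesis
    using power_mono[OF _ \<open>0 \<le> eta_gap s \<gamma> \<mu>\<close>, of _ 2] assms(1) by fastforce
qed

text \<open>Below \<open>eta_loc\<close> the denominator \<open>c_sp\<close> is positive.\<close>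

lemma eta_loc_bound:
  assumes "0 < \<gamma>" "C2_bar s \<gamma> \<mu> < 2 / 3" "d < eta_loc s \<gamma> \<mu>"
  shows "(2 / sqrt 5 + 2 / 3) * d < 2 / 3 - C2_bar s \<gamma> \<mu>"
proof -
  define a where "a = sqrt 3 / 2 * \<gamma>"
  define b :: real where "b = 2 / sqrt 5 + 2 / 3"
  define c where "c = 2 / 3 - C2_bar s \<gamma> \<mu>"
  have abc: "0 < a" "0 < b" "0 < c"
    using assms by (simp_all add: a_def b_def c_def add_pos_pos)
  have "d < a * c / (1 + a * b)"
    using assms(3) by (simp add: eta_loc_def a_def b_def c_def)
  then have "b * d < b * (a * c / (1 + a * b))"
    using abc(2) by (rule mult_strict_left_mono)
  also have "\<dots> \<le> c"
    using abc by (simp add: field_simps add_pos_pos)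
  finally show ?thesis
    by (simp add: b_def c_def)
qed

theorem corollary2p4:
  fixes s :: nat and \<gamma> \<mu> :: real
  assumes "s \<ge> 2" and "\<gamma> > 0" and "0 \<le> \<mu>" and "\<mu> < 1"
    and "C2_bar s \<gamma> \<mu> < 2 / 3" and "A_star s \<gamma> \<mu> > 0"
  shows "(\<forall>\<kappa>>0. \<forall>X\<in>uniform_class s \<kappa> \<gamma> \<mu>. \<forall>Y\<in>uniform_class s \<kappa> \<gamma> \<mu>.
            d_sp \<kappa> X Y \<le> \<kappa> * sqrt (real s) / sqrt (3 * (1 - \<mu>)) * d_match X Y
          \<and> (d_sp \<kappa> X Y < eta_star s \<gamma> \<mu> \<longrightarrow>
               d_match X Y \<le> 2 / (sqrt 3 * c_sp s \<kappa> \<gamma> \<mu> X Y) * (d_sp \<kappa> X Y / \<kappa>)))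
       \<and> (\<exists>L1>0. \<exists>L2>0. \<forall>\<kappa>>0. \<forall>X\<in>uniform_class s \<kappa> \<gamma> \<mu>. \<forall>Y\<in>uniform_class s \<kappa> \<gamma> \<mu>.
            d_sp \<kappa> X Y < eta_star s \<gamma> \<mu> \<longrightarrow>
              L1 * (\<kappa> * d_match X Y) \<le> d_sp \<kappa> X Y
            \<and> d_sp \<kappa> X Y \<le> L2 * (\<kappa> * d_match X Y))"
proof -
  \<comment> \<open>Neither constant involves \<kappa> or the configurations, so both may be chosen
    before these are quantified.\<close>
  define L1 where "L1 = sqrt 3 / 2 * (2 / 3 - C2_bar s \<gamma> \<mu>)"
  define L2 where "L2 = sqrt (real s) / sqrt (3 * (1 - \<mu>))"
  have L: "0 < L1" "0 < L2"
    using assms by (simp_all add: L1_def L2_def)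
  have two: "two_configs s \<kappa> \<gamma> \<mu> X Y"
    if "0 < \<kappa>" "X \<in> uniform_class s \<kappa> \<gamma> \<mu>" "Y \<in> uniform_class s \<kappa> \<gamma> \<mu>" for \<kappa> X Y
    using assms that by (simp add: two_configs_def config_def)
  have upper: "d_sp \<kappa> X Y \<le> \<kappa> * sqrt (real s) / sqrt (3 * (1 - \<mu>)) * d_match X Y"
    if "0 < \<kappa>" "X \<in> uniform_class s \<kappa> \<gamma> \<mu>" "Y \<in> uniform_class s \<kappa> \<gamma> \<mu>" for \<kappa> X Y
    by (rule two_configs.upper_bound[OF two[OF that]])
  have lower: "L1 * (\<kappa> * d_match X Y) \<le> d_sp \<kappa> X Y"
    if "0 < \<kappa>" "X \<in> uniform_class s \<kappa> \<gamma> \<mu>" "Y \<in> uniform_class s \<kappa> \<gamma> \<mu>" "d_sp \<kappa> X Y < eta_star s \<gamma> \<mu>" for \<kappa> X Y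
  proof -
    have "(d_sp \<kappa> X Y)\<^sup>2 < (eta_gap s \<gamma> \<mu>)\<^sup>2"
      using that(4) two_configs.d_sp_nonneg[OF two[OF that(1-3)]] by (intro power_strict_mono) (simp_all add: eta_star_def)
    also have "\<dots> \<le> A_star s \<gamma> \<mu>"
      using assms by (intro eta_gap_le)
    finally show ?thesis
      unfolding L1_def by (rule two_configs.lower_bound[OF two[OF that(1-3)] assms(5)])
  qed
  have match: "d_match X Y \<le> 2 / (sqrt 3 * c_sp s \<kappa> \<gamma> \<mu> X Y) * (d_sp \<kappa> X Y / \<kappa>)"
    if h: "0 < \<kappa>" "X \<in> uniform_class s \<kappa> \<gamma> \<mu>" "Y \<in> uniform_class s \<kappa> \<gamma> \<mu>" "d_sp \<kappa> X Y < eta_star s \<gamma> \<mu>" for \<kappa> X Y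
  proof -
    have d: "0 \<le> d_sp \<kappa> X Y"
      by (rule two_configs.d_sp_nonneg[OF two[OF h(1-3)]])
    have "d_match X Y \<le> d_sp \<kappa> X Y / \<kappa> / L1"
      using lower[OF h] L h(1) by (simp add: pos_le_divide_eq mult_ac)
    \<comment> \<open>\<open>c_sp\<close> arises from \<open>2 / 3 - C2_bar s \<gamma> \<mu>\<close>
      by subtracting a nonnegative multiple of \<open>d_sp\<close>, so dividing by the smaller
      positive number weakens the bound to the stated one.\<close>
    also have "\<dots> \<le> d_sp \<kappa> X Y / \<kappa> / (sqrt 3 / 2 * c_sp s \<kappa> \<gamma> \<mu> X Y)"
    proof (rule divide_left_mono)
      have "0 < c_sp s \<kappa> \<gamma> \<mu> X Y"
        using eta_loc_bound[OF assms(2,5), of "d_sp \<kappa> X Y"] h(4) by (simp add: c_sp_def eta_star_def)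
      then show "0 < L1 * (sqrt 3 / 2 * c_sp s \<kappa> \<gamma> \<mu> X Y)"
        using L by simp
      have "0 \<le> (2 / sqrt 5 + 2 / 3) * d_sp \<kappa> X Y"
        using d by simp
      then show "sqrt 3 / 2 * c_sp s \<kappa> \<gamma> \<mu> X Y \<le> L1"
        unfolding L1_def c_sp_def by (intro mult_left_mono) simp_all
    qed (use d h(1) in simp)
    finally show ?thesis
      by (simp add: mult.commute)
  qed
  have "L1 * (\<kappa> * d_match X Y) \<le> d_sp \<kappa> X Y \<and> d_sp \<kappa> X Y \<le> L2 * (\<kappa> * d_match X Y)"
    if "0 < \<kappa>" "X \<in> uniform_class s \<kappa> \<gamma> \<mu>" "Y \<in> uniform_class s \<kappa> \<gamma> \<mu>" "d_sp \<kappa> X Y < eta_star s \<gamma> \<mu>" for \<kappa> X Y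
    using lower[OF that] upper[OF that(1-3)] by (simp add: L2_def mult_ac)
  with L have "\<exists>L1>0. \<exists>L2>0. \<forall>\<kappa>>0. \<forall>X\<in>uniform_class s \<kappa> \<gamma> \<mu>. \<forall>Y\<in>uniform_class s \<kappa> \<gamma> \<mu>.
            d_sp \<kappa> X Y < eta_star s \<gamma> \<mu> \<longrightarrow>
              L1 * (\<kappa> * d_match X Y) \<le> d_sp \<kappa> X Y
            \<and> d_sp \<kappa> X Y \<le> L2 * (\<kappa> * d_match X Y)"
    by blast
  with upper match show ?thesis
    by blast
qed

end
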